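(* Let $n\ge2$ and $m\ge 2$ be integers, and let $f=\sum_{j=1}^n c_jz_j^m$ and $g=\sum_{k=1}^n d_kz_k^m$ be homogeneous polynomials in $\mathbb{C}[z_1,\ldots,z_n]$, where $c_j\neq0$ and $d_k\ne0$ for all $j$ and $k$, and $c_jd_k-c_kd_j\neq0$ for all $j\neq k$. For every sufficiently small $\varepsilon>0$, let $\Phi:S_\varepsilon\setminus K_{fg}\to T^2$ be the Milnor fibration product map associated with $f$ and $g$. Then, for $m=2$, $\Phi$ is a fold map. For $m>2$, $\Phi$ has no fold point, although it has singular points.
   Context: $S_\varepsilon=\{z\in\mathbb{C}^n\mid \|z\|=\varepsilon\}$ and $K_{fg}=\{z\in S_\varepsilon\mid f(z)g(z)=0\}$. The Milnor fibration product map associated with $f,g$ is the $C^\infty$ map $\Phi:S_\varepsilon\setminus K_{fg}\to S^1\times S^1=T^2$, $\Phi(z)=\left(\frac{f(z)}{|f(z)|},\frac{g(z)}{|g(z)|}\right)$. A point $p$ is a singular point of $\Phi$ if $\mathrm{rank}\,d\Phi_p<2$. "For every sufficiently small $\varepsilon>0$" means: there is $\varepsilon_0>0$ (depending on $f,g$) such that the assertion holds for all $0<\varepsilon\le\varepsilon_0$. Fold point: a singular point $p$ of a $C^\infty$ map $\Phi$ from a $(2n-1)$-manifold to a $2$-manifold is a fold point if there are local coordinates $(x_1,\ldots,x_{2n-1})$ centered at $p$ and $(y_1,y_2)$ centered at $\Phi(p)$ in which $y_1\circ\Phi=x_{2n-1}$ and $y_2\circ\Phi=-x_1^2-\cdots-x_\lambda^2+x_{\lambda+1}^2+\cdots+x_{2n-2}^2$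 for some $0\le\lambda\le 2n-2$. A fold map is a $C^\infty$ map all of whose singular points are fold points. *)

theory Defs
  imports "HOL-Analysis.Analysis"
begin

text \<open>
  Manifolds are represented as subsets of a Euclidean space.  A map on an arbitrary subset is
  smooth if it locally extends to a smooth map on an open set of the ambient space, and a system
  of local coordinates is a diffeomorphism, in this sense, from a relatively open set onto an open
  set of the model space.
\<close>

text \<open>\<open>Ck k S f\<close> is meant for open \<open>S\<close>; the second clause says that all directional derivatives of
  \<open>f\<close> are again of class \<open>C\<^sup>k\<close>.\<close>

fun Ck :: "nat \<Rightarrow> 'a::euclidean_space set \<Rightarrow> ('a \<Rightarrow> 'b::euclidean_space) \<Rightarrow> bool" where
  "Ck 0 S f \<longleftrightarrow> continuous_on S f"
| "Ck (Suc k) S f \<longleftrightarrow> (\<forall>x\<in>S. f differentiable (at x)) \<and>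
     (\<forall>v. Ck k S (\<lambda>x. frechet_derivative f (at x) v))"

definition smooth_on_open :: "'a::euclidean_space set \<Rightarrow> ('a \<Rightarrow> 'b::euclidean_space) \<Rightarrow> bool" where
  "smooth_on_open S f \<longleftrightarrow> open S \<and> (\<forall>k. Ck k S f)"

definition smooth_map :: "'a::euclidean_space set \<Rightarrow> ('a \<Rightarrow> 'b::euclidean_space) \<Rightarrow> bool" where
  "smooth_map X f \<longleftrightarrow>
     (\<forall>x\<in>X. \<exists>U F. x \<in> U \<and> smooth_on_open U F \<and> (\<forall>y\<in>U \<inter> X. F y = f y))"

definition local_coords ::
  "'a::euclidean_space set \<Rightarrow> 'a \<Rightarrow> 'a set \<Rightarrow> ('a \<Rightarrow> 'c::euclidean_space) \<Rightarrow> bool" where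
  "local_coords M p U x \<longleftrightarrow>
     openin (top_of_set M) U \<and> p \<in> U \<and> open (x ` U) \<and> inj_on x U \<and>
     smooth_map U x \<and> smooth_map (x ` U) (inv_into U x) \<and> x p = 0"

definition smooth_curve :: "'a::euclidean_space set \<Rightarrow> 'a \<Rightarrow> (real \<Rightarrow> 'a) \<Rightarrow> 'a \<Rightarrow> bool" where
  "smooth_curve M p \<gamma> v \<longleftrightarrow>
     (\<exists>e>0. smooth_on_open {-e<..<e} \<gamma> \<and> \<gamma> ` {-e<..<e} \<subseteq> M) \<and>
     \<gamma> 0 = p \<and> (\<gamma> has_vector_derivative v) (at 0)"

definition tangent_space :: "'a::euclidean_space set \<Rightarrow> 'a \<Rightarrow> 'a set" where
  "tangent_space M p = {v. \<exists>\<gamma>. smooth_curve M p \<gamma> v}"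

text \<open>The differential at \<open>p\<close> sends the velocity of a curve in \<open>M\<close> to the velocity of its image.  It
  is meant for \<open>v\<close> in the tangent space and \<open>\<Phi>\<close> smooth on \<open>M\<close>, where it does not depend on the
  curve.\<close>

definition differential ::
  "'a::euclidean_space set \<Rightarrow> ('a \<Rightarrow> 'b::euclidean_space) \<Rightarrow> 'a \<Rightarrow> 'a \<Rightarrow> 'b" where
  "differential M \<Phi> p v =
     (THE w. \<forall>\<gamma>. smooth_curve M p \<gamma> v \<longrightarrow> ((\<Phi> \<circ> \<gamma>) has_vector_derivative w) (at 0))"

definition rank_at :: "'a::euclidean_space set \<Rightarrow> ('a \<Rightarrow> 'b::euclidean_space) \<Rightarrow> 'a \<Rightarrow> nat" where
  "rank_at M \<Phi> p = dim (differential M \<Phi> p ` tangent_space M p)"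

text \<open>The threshold 2 is the dimension of the target manifold.\<close>

definition singular_point :: "'a::euclidean_space set \<Rightarrow> ('a \<Rightarrow> 'b::euclidean_space) \<Rightarrow> 'a \<Rightarrow> bool" where
  "singular_point M \<Phi> p \<longleftrightarrow> p \<in> M \<and> rank_at M \<Phi> p < 2"

text \<open>An index type with elements \<open>1, \<dots>, 2n - 1\<close>, where \<open>n = CARD('n)\<close>, so that
  \<open>real ^ 'n cidx\<close> is the space of coordinates \<open>(x\<^sub>1, \<dots>, x\<^bsub>2n-1\<^esub>)\<close> on a hypersurface in
  \<open>complex ^ 'n\<close>.\<close>

typedef 'n cidx = "{1..2 * CARD('n::finite) - 1}"
proof
  have "CARD('n) > 0" by simp
  then have "1 \<le> 2 * CARD('n) - 1" by linarith
  then show "1 \<in> {1..2 * CARD('n) - 1}" by simp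
qed

instance cidx :: (finite) finite
proof
  show "finite (UNIV :: 'a cidx set)"
    unfolding type_definition.univ [OF type_definition_cidx] by simp
qed

lemma card_cidx: "CARD('n::finite cidx) = 2 * CARD('n) - 1"
  unfolding type_definition.card [OF type_definition_cidx] by simp

definition coord :: "real ^ 'n::finite cidx \<Rightarrow> nat \<Rightarrow> real" where
  "coord x i = x $ Abs_cidx i"

definition fold_point ::
  "(complex ^ 'n::finite) set \<Rightarrow> 'b::euclidean_space set \<Rightarrow> (complex ^ 'n \<Rightarrow> 'b) \<Rightarrow> complex ^ 'n \<Rightarrow> bool"
where
  "fold_point M N \<Phi> p \<longleftrightarrow> singular_point M \<Phi> p \<and>
     (\<exists>U (x :: complex ^ 'n \<Rightarrow> real ^ 'n cidx) V (y :: 'b \<Rightarrow> real \<times> real) l.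
        local_coords M p U x \<and> local_coords N (\<Phi> p) V y \<and> \<Phi> ` U \<subseteq> V \<and>
        l \<le> 2 * CARD('n) - 2 \<and>
        (\<forall>q\<in>U.
           fst (y (\<Phi> q)) = coord (x q) (2 * CARD('n) - 1) \<and>
           snd (y (\<Phi> q)) =
             - (\<Sum>i = 1..l. (coord (x q) i)\<^sup>2) + (\<Sum>i = l + 1..2 * CARD('n) - 2. (coord (x q) i)\<^sup>2)))"

definition fold_map ::
  "(complex ^ 'n::finite) set \<Rightarrow> 'b::euclidean_space set \<Rightarrow> (complex ^ 'n \<Rightarrow> 'b) \<Rightarrow> bool" where
  "fold_map M N \<Phi> \<longleftrightarrow> smooth_map M \<Phi> \<and> \<Phi> ` M \<subseteq> N \<and>
     (\<forall>p. singular_point M \<Phi> p \<longrightarrow> fold_point M N \<Phi> p)"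

definition milnor_link ::
  "(complex ^ 'n::finite \<Rightarrow> complex) \<Rightarrow> (complex ^ 'n \<Rightarrow> complex) \<Rightarrow> real \<Rightarrow> (complex ^ 'n) set" where
  "milnor_link f g \<epsilon> = {z \<in> sphere 0 \<epsilon>. f z * g z = 0}"

definition milnor_product ::
  "(complex ^ 'n::finite \<Rightarrow> complex) \<Rightarrow> (complex ^ 'n \<Rightarrow> complex) \<Rightarrow> complex ^ 'n \<Rightarrow> complex \<times> complex"
where
  "milnor_product f g z = (f z / of_real (cmod (f z)), g z / of_real (cmod (g z)))"

definition torus :: "(complex \<times> complex) set" where
  "torus = sphere 0 1 \<times> sphere 0 1"

end

theory Submission
  imports Defs "HOL-Complex_Analysis.Cauchy_Integral_Formula"
begin

text \<open>
  Homogeneity makes the arguments of \<open>f\<close> and \<open>g\<close> constant along rays, so at a singular point some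
  nontrivial combination \<open>\<alpha> df/f + \<beta> dg/g\<close> vanishes.  As the minors \<open>c\<^sub>j d\<^sub>k - c\<^sub>k d\<^sub>j\<close> are nonzero, this
  happens exactly on the coordinate axes.  Let \<open>p\<close> lie on the \<open>j\<close>-th axis and put \<open>F = f/f(p)\<close>,
  \<open>G = g/g(p)\<close>.

  For \<open>m = 2\<close>, the quotient \<open>G/F\<close> equals \<open>1 + \<Sum> e\<^sub>k (z\<^sub>k/p\<^sub>j)\<^sup>2/F\<close> with \<open>e\<^sub>k = d\<^sub>k/d\<^sub>j - c\<^sub>k/c\<^sub>j\<close> nonzero for
  \<open>k \<noteq> j\<close>.  With \<open>r = Re (G/F)\<close>, \<open>\<kappa>\<^sub>k\<^sup>2 = -i e\<^sub>k\<close> and \<open>v\<^sub>k = \<kappa>\<^sub>k (z\<^sub>k/p\<^sub>j) / (F r)\<^bsup>1/2\<^esup>\<close>, the slope \<open>Im/Re\<close> of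
  \<open>G/F\<close> is exactly \<open>\<Sum> Re v\<^sub>k\<^sup>2 = \<Sum> ((Re v\<^sub>k)\<^sup>2 - (Im v\<^sub>k)\<^sup>2)\<close>.  So the \<open>v\<^sub>k\<close> and the slope of \<open>F\<close> are Morse
  coordinates, and their inverse is explicit.

  For \<open>m > 2\<close>, the phase difference of \<open>G\<close> and \<open>F\<close> is \<open>o(s\<^sup>2)\<close> along every curve \<open>s \<mapsto> z(s)\<close> through \<open>p\<close>.
  In fold coordinates the two target directions are reached at the rates \<open>s\<close> and \<open>\<plusminus>s\<^sup>2\<close>, so the
  differential of the phase difference on the torus would vanish at \<open>\<Phi>(p)\<close>, but it does not.
\<close>

section \<open>Smooth maps\<close>

lemma Ck_cong:
  assumes "open S" "\<And>x. x \<in> S \<Longrightarrow> f x = g x" "Ck k S f"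
  shows "Ck k S g"
  using assms(2,3)
proof (induction k arbitrary: f g)
  case 0
  then show ?case using continuous_on_cong by force
next
  case (Suc k)
  have d: "(g has_derivative frechet_derivative f (at x)) (at x)" if "x \<in> S" for x
  proof -
    have "(f has_derivative frechet_derivative f (at x)) (at x)"
      using Suc.prems(2) that by (simp add: frechet_derivative_works)
    then show ?thesis
      by (rule has_derivative_transform_within_open[OF _ assms(1) that]) (use Suc.prems in auto)
  qed
  have "Ck k S (\<lambda>x. frechet_derivative g (at x) v)" for v
    by (rule Suc.IH[of "\<lambda>x. frechet_derivative f (at x) v"])
       (use Suc.prems(2) frechet_derivative_at[OF d] in auto)
  then show ?case using d by (auto simp: differentiable_def)
qed

text \<open>Uniqueness of the derivative lets an explicit formula \<open>f'\<close> replace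
  \<open>frechet_derivative\<close>, so that the closure properties below reduce to differentiation
  rules.\<close>

lemma Ck_Suc_intro:
  assumes "open S" "\<And>x. x \<in> S \<Longrightarrow> (f has_derivative f' x) (at x)"
    and "\<And>v. Ck k S (\<lambda>x. f' x v)"
  shows "Ck (Suc k) S f"
proof -
  have "Ck k S (\<lambda>x. frechet_derivative f (at x) v)" for v
    by (rule Ck_cong[OF assms(1) _ assms(3)[of v]])
       (use frechet_derivative_at[OF assms(2)] in auto)
  then show ?thesis using assms(2) by (auto simp: differentiable_def)
qed

lemma Ck_has_derivative:
  assumes "Ck (Suc k) S f" "x \<in> S"
  shows "(f has_derivative frechet_derivative f (at x)) (at x)"
  using assms by (simp add: frechet_derivative_works)

lemma Ck_SucD: "Ck (Suc k) S f \<Longrightarrow> Ck k S f"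
proof (induction k arbitrary: f)
  case 0
  then show ?case
    by (auto intro!: differentiable_imp_continuous_on simp: differentiable_on_def differentiable_at_withinI)
qed auto

lemma Ck_subset: "Ck k S f \<Longrightarrow> T \<subseteq> S \<Longrightarrow> Ck k T f"
  by (induction k arbitrary: f) (auto intro: continuous_on_subset)

lemma Ck_const: "open S \<Longrightarrow> Ck k S (\<lambda>x. c)"
  by (induction k arbitrary: c) (auto intro!: Ck_Suc_intro[where f'="\<lambda>_ _. 0"] simp del: Ck.simps(2))

lemma Ck_linear: "open S \<Longrightarrow> bounded_linear L \<Longrightarrow> Ck k S L"
  by (cases k) (auto intro!: Ck_Suc_intro[where f'="\<lambda>_. L"] Ck_const bounded_linear_imp_has_derivative
     linear_continuous_on simp del: Ck.simps(2))

lemma Ck_add: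
  assumes "open S" shows "Ck k S f \<Longrightarrow> Ck k S g \<Longrightarrow> Ck k S (\<lambda>x. f x + g x)"
proof (induction k arbitrary: f g)
  case 0
  then show ?case by (auto intro!: continuous_intros)
next
  case (Suc k)
  show ?case
    by (rule Ck_Suc_intro[OF assms has_derivative_add, OF Ck_has_derivative Ck_has_derivative])
       (use Suc in auto)
qed

lemma Ck_sum:
  assumes "open S" "\<And>i. i \<in> I \<Longrightarrow> Ck k S (f i)"
  shows "Ck k S (\<lambda>x. \<Sum>i\<in>I. f i x)"
  using assms(2) by (induction I rule: infinite_finite_induct) (auto intro!: Ck_const Ck_add assms(1))

text \<open>The product rule also involves \<open>f\<close> and \<open>g\<close> undifferentiated,
  hence the use of \<open>Ck_SucD\<close>. Products, scalar multiples and inner products are all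
  instances.\<close>

lemma Ck_bilinear:
  assumes "open S" "bounded_bilinear h"
  shows "Ck k S f \<Longrightarrow> Ck k S g \<Longrightarrow> Ck k S (\<lambda>x. h (f x) (g x))"
proof (induction k arbitrary: f g)
  case 0
  then show ?case using bounded_bilinear.continuous_on[OF assms(2)] by auto
next
  case (Suc k)
  show ?case
  proof (rule Ck_Suc_intro[OF assms(1) bounded_bilinear.FDERIV[OF assms(2)],
      OF Ck_has_derivative Ck_has_derivative])
    fix v
    show "Ck k S (\<lambda>x. h (f x) (frechet_derivative g (at x) v) + h (frechet_derivative f (at x) v) (g x))"
      using Suc.prems by (intro Ck_add Suc.IH assms(1)) (auto dest: Ck_SucD simp del: Ck.simps(2), auto)
  qed (use Suc in auto)
qed

text \<open>In the chain rule the direction fed to the derivative of \<open>g\<close> varies with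
  \<open>x\<close>, whereas \<open>Ck\<close> controls derivatives in fixed directions. Expanding in
  \<open>Basis\<close> leaves fixed directions \<open>b\<close> with varying scalar
  coefficients.\<close>

lemma Ck_compose:
  fixes f :: "'a::euclidean_space \<Rightarrow> 'b::euclidean_space" and g :: "'b \<Rightarrow> 'c::euclidean_space"
  assumes "open S" "open T"
  shows "Ck k S f \<Longrightarrow> Ck k T g \<Longrightarrow> f ` S \<subseteq> T \<Longrightarrow> Ck k S (\<lambda>x. g (f x))"
proof (induction k arbitrary: f g)
  case 0
  then show ?case using continuous_on_compose2 by auto
next
  case (Suc k)
  have d: "((\<lambda>x. g (f x)) has_derivative
      (\<lambda>v. \<Sum>b\<in>Basis. (frechet_derivative f (at x) v \<bullet> b) *\<^sub>R frechet_derivative g (at (f x)) b)) (at x)"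
    if "x \<in> S" for x
  proof -
    have f: "(f has_derivative frechet_derivative f (at x)) (at x)"
      using Suc.prems that by (auto intro: Ck_has_derivative)
    have g: "(g has_derivative frechet_derivative g (at (f x))) (at (f x))"
      by (rule Ck_has_derivative[OF Suc.prems(2)]) (use Suc.prems(3) that in blast)
    have l: "linear (frechet_derivative g (at (f x)))" using g has_derivative_linear by blast
    have "frechet_derivative g (at (f x)) w = (\<Sum>b\<in>Basis. (w \<bullet> b) *\<^sub>R frechet_derivative g (at (f x)) b)" for w
      using linear_sum[OF l, of "\<lambda>b. (w \<bullet> b) *\<^sub>R b" Basis]
      by (simp add: linear_cmul[OF l] euclidean_representation)
    then have "(\<lambda>v. \<Sum>b\<in>Basis. (frechet_derivative f (at x) v \<bullet> b) *\<^sub>R frechet_derivative g (at (f x)) b)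
      = (\<lambda>v. frechet_derivative g (at (f x)) (frechet_derivative f (at x) v))" by metis
    then show ?thesis using has_derivative_compose[OF f g] by simp
  qed
  show ?case
  proof (rule Ck_Suc_intro[OF assms(1) d])
    fix v
    have "Ck k S (\<lambda>x. frechet_derivative f (at x) v \<bullet> b)" for b
      by (rule Ck_bilinear[OF assms(1) bounded_bilinear_inner _ Ck_const[OF assms(1)]])
         (use Suc.prems(1) in simp)
    moreover have "Ck k S (\<lambda>x. frechet_derivative g (at (f x)) b)" for b
      using Suc.IH[of f "\<lambda>y. frechet_derivative g (at y) b"] Ck_SucD[OF Suc.prems(1)] Suc.prems(2,3) by simp
    ultimately show "Ck k S (\<lambda>x. \<Sum>b\<in>Basis. (frechet_derivative f (at x) v \<bullet> b) *\<^sub>R frechet_derivative g (at (f x)) b)"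
      by (intro Ck_sum assms(1) Ck_bilinear[OF _ bounded_bilinear_scaleR])
  qed
qed

text \<open>Each directional derivative \<open>deriv f x * v\<close> is again holomorphic in
  \<open>x\<close>. This is the source of smoothness for \<open>csqrt\<close> and
  \<open>inverse\<close> and, through real parts, for \<open>sqrt\<close> and real
  quotients.\<close>

lemma Ck_holomorphic:
  assumes "open S"
  shows "f holomorphic_on S \<Longrightarrow> Ck k S f"
proof (induction k arbitrary: f)
  case 0
  then show ?case by (simp add: holomorphic_on_imp_continuous_on)
next
  case (Suc k)
  have "(f has_derivative (\<lambda>v. deriv f x * v)) (at x)" if "x \<in> S" for x
    using holomorphic_derivI[OF Suc.prems assms that] by (simp add: has_field_derivative_def)
  moreover have "(\<lambda>x. deriv f x * v) holomorphic_on S" for v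
    using Suc.prems assms by (intro holomorphic_on_mult holomorphic_deriv holomorphic_on_const)
  ultimately show ?case
    using Ck_Suc_intro[OF assms, of f "\<lambda>x v. deriv f x * v"] Suc.IH by blast
qed

section \<open>Closure properties of smooth maps on open sets\<close>

named_theorems smooth_intros

lemma smooth_on_openD: "smooth_on_open S f \<Longrightarrow> open S"
  by (simp add: smooth_on_open_def)

lemma smooth_on_open_subset: "smooth_on_open S f \<Longrightarrow> open T \<Longrightarrow> T \<subseteq> S \<Longrightarrow> smooth_on_open T f"
  unfolding smooth_on_open_def using Ck_subset by blast

lemma smooth_on_open_cong:
  "smooth_on_open S f \<Longrightarrow> (\<And>x. x \<in> S \<Longrightarrow> f x = g x) \<Longrightarrow> smooth_on_open S g"
  unfolding smooth_on_open_def using Ck_cong[of S f g] by blast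

lemma smooth_on_open_has_derivative:
  assumes "smooth_on_open S f" "x \<in> S"
  shows "(f has_derivative frechet_derivative f (at x)) (at x)"
proof -
  have "Ck (Suc 0) S f" using assms(1) unfolding smooth_on_open_def by blast
  then show ?thesis using assms(2) by (rule Ck_has_derivative)
qed

lemma smooth_on_open_continuous_on: "smooth_on_open S f \<Longrightarrow> continuous_on S f"
  unfolding smooth_on_open_def using Ck.simps(1) by blast

lemma smooth_on_open_compose:
  "smooth_on_open T g \<Longrightarrow> smooth_on_open S f \<Longrightarrow> f ` S \<subseteq> T \<Longrightarrow> smooth_on_open S (\<lambda>x. g (f x))"
  unfolding smooth_on_open_def using Ck_compose[of S T _ f g] by blast

lemma smooth_on_open_const [smooth_intros]: "open S \<Longrightarrow> smooth_on_open S (\<lambda>x. c)"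
  by (simp add: smooth_on_open_def Ck_const)

lemma smooth_on_open_linear: "open S \<Longrightarrow> bounded_linear L \<Longrightarrow> smooth_on_open S L"
  by (simp add: smooth_on_open_def Ck_linear)

lemma smooth_on_open_ident [smooth_intros]: "open S \<Longrightarrow> smooth_on_open S (\<lambda>x. x)"
  by (simp add: smooth_on_open_linear bounded_linear_ident)

lemma smooth_on_open_linear_compose:
  "bounded_linear L \<Longrightarrow> smooth_on_open S f \<Longrightarrow> smooth_on_open S (\<lambda>x. L (f x))"
  by (rule smooth_on_open_compose[OF smooth_on_open_linear[OF open_UNIV]]) auto

lemmas smooth_on_open_linears [smooth_intros] =
  smooth_on_open_linear_compose[OF bounded_linear_Re]
  smooth_on_open_linear_compose[OF bounded_linear_Im]
  smooth_on_open_linear_compose[OF bounded_linear_fst]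
  smooth_on_open_linear_compose[OF bounded_linear_snd]
  smooth_on_open_linear_compose[OF bounded_linear_of_real]
  smooth_on_open_linear_compose[OF bounded_linear_vec_nth]

lemma smooth_on_open_bilinear:
  "bounded_bilinear h \<Longrightarrow> smooth_on_open S f \<Longrightarrow> smooth_on_open S g \<Longrightarrow>
    smooth_on_open S (\<lambda>x. h (f x) (g x))"
  by (simp add: smooth_on_open_def Ck_bilinear)

lemmas smooth_on_open_bilinears [smooth_intros] =
  smooth_on_open_bilinear[OF bounded_bilinear_mult]
  smooth_on_open_bilinear[OF bounded_bilinear_scaleR]
  smooth_on_open_bilinear[OF bounded_bilinear_inner]

lemma smooth_on_open_add [smooth_intros]:
  "smooth_on_open S f \<Longrightarrow> smooth_on_open S g \<Longrightarrow> smooth_on_open S (\<lambda>x. f x + g x)"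
  by (simp add: smooth_on_open_def Ck_add)

lemma smooth_on_open_minus [smooth_intros]:
  "smooth_on_open S f \<Longrightarrow> smooth_on_open S (\<lambda>x. - f x)"
  by (rule smooth_on_open_linear_compose[OF bounded_linear_minus[OF bounded_linear_ident]])

lemma smooth_on_open_diff [smooth_intros]:
  "smooth_on_open S f \<Longrightarrow> smooth_on_open S g \<Longrightarrow> smooth_on_open S (\<lambda>x. f x - g x)"
  unfolding diff_conv_add_uminus by (intro smooth_intros)

lemma smooth_on_open_sum [smooth_intros]:
  "open S \<Longrightarrow> (\<And>i. i \<in> I \<Longrightarrow> smooth_on_open S (f i)) \<Longrightarrow> smooth_on_open S (\<lambda>x. \<Sum>i\<in>I. f i x)"
  by (simp add: smooth_on_open_def Ck_sum)

lemma smooth_on_open_power [smooth_intros]: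
  fixes f :: "'a::euclidean_space \<Rightarrow> 'b::{euclidean_space,real_normed_algebra_1}"
  shows "smooth_on_open S f \<Longrightarrow> smooth_on_open S (\<lambda>x. f x ^ k)"
  by (induction k) (auto intro: smooth_intros dest: smooth_on_openD)

lemma smooth_on_open_Pair [smooth_intros]:
  assumes "smooth_on_open S f" "smooth_on_open S g"
  shows "smooth_on_open S (\<lambda>x. (f x, g x))"
proof -
  have "smooth_on_open S (\<lambda>x. (f x, 0) + (0, g x))"
    by (intro smooth_on_open_add
        smooth_on_open_linear_compose[OF bounded_linear_Pair[OF bounded_linear_ident bounded_linear_zero] assms(1)]
        smooth_on_open_linear_compose[OF bounded_linear_Pair[OF bounded_linear_zero bounded_linear_ident] assms(2)])
  then show ?thesis by simp
qed

lemma smooth_on_open_vec_lambda [smooth_intros]: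
  fixes f :: "'i::finite \<Rightarrow> 'a::euclidean_space \<Rightarrow> 'b::euclidean_space"
  assumes "open S" "\<And>i. smooth_on_open S (f i)"
  shows "smooth_on_open S (\<lambda>x. \<chi> i. f i x)"
proof -
  have l: "bounded_linear (axis i :: 'b \<Rightarrow> 'b ^ 'i)" for i
    by (intro linear_conv_bounded_linear[THEN iffD1] linearI) (auto simp: axis_def vec_eq_iff)
  have "smooth_on_open S (\<lambda>x. \<Sum>i\<in>UNIV. axis i (f i x))"
    by (intro smooth_intros smooth_on_open_linear_compose[OF l] assms)
  moreover have "(\<Sum>i\<in>UNIV. axis i (f i x)) = (\<chi> i. f i x)" for x
    by (simp add: vec_eq_iff axis_def if_distrib[of "\<lambda>y. vec_nth y _"] sum.delta cong: if_cong)
  ultimately show ?thesis by simp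
qed

lemma smooth_on_open_holomorphic:
  "g holomorphic_on T \<Longrightarrow> open T \<Longrightarrow> smooth_on_open S f \<Longrightarrow> f ` S \<subseteq> T \<Longrightarrow> smooth_on_open S (\<lambda>x. g (f x))"
  by (rule smooth_on_open_compose[of T]) (auto simp: smooth_on_open_def Ck_holomorphic)

lemma smooth_on_open_csqrt [smooth_intros]:
  assumes "smooth_on_open S f" "\<And>x. x \<in> S \<Longrightarrow> f x \<notin> \<real>\<^sub>\<le>\<^sub>0"
  shows "smooth_on_open S (\<lambda>x. csqrt (f x))"
  by (rule smooth_on_open_holomorphic[where g=csqrt and f=f and T="- \<real>\<^sub>\<le>\<^sub>0"])
     (use assms in \<open>auto intro!: holomorphic_intros\<close>)

lemma smooth_on_open_inverse_complex:
  fixes f :: "'a::euclidean_space \<Rightarrow> complex"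
  assumes "smooth_on_open S f" "\<And>x. x \<in> S \<Longrightarrow> f x \<noteq> 0"
  shows "smooth_on_open S (\<lambda>x. inverse (f x))"
  by (rule smooth_on_open_holomorphic[where g=inverse and f=f and T="- {0}"])
     (use assms in \<open>auto intro!: holomorphic_intros\<close>)

lemma smooth_on_open_divide_complex [smooth_intros]:
  fixes f g :: "'a::euclidean_space \<Rightarrow> complex"
  assumes "smooth_on_open S f" "smooth_on_open S g" "\<And>x. x \<in> S \<Longrightarrow> g x \<noteq> 0"
  shows "smooth_on_open S (\<lambda>x. f x / g x)"
  unfolding divide_inverse by (intro smooth_intros smooth_on_open_inverse_complex assms)

lemma smooth_on_open_divide_real [smooth_intros]:
  fixes f g :: "'a::euclidean_space \<Rightarrow> real"
  assumes "smooth_on_open S f" "smooth_on_open S g" "\<And>x. x \<in> S \<Longrightarrow> g x \<noteq> 0"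
  shows "smooth_on_open S (\<lambda>x. f x / g x)"
proof -
  have "smooth_on_open S (\<lambda>x. Re (of_real (f x) / of_real (g x)))"
    by (intro smooth_intros assms) (use assms in auto)
  then show ?thesis by (simp flip: of_real_divide)
qed

lemma smooth_on_open_sqrt [smooth_intros]:
  assumes "smooth_on_open S f" "\<And>x. x \<in> S \<Longrightarrow> f x > 0"
  shows "smooth_on_open S (\<lambda>x. sqrt (f x))"
proof (rule smooth_on_open_cong)
  show "smooth_on_open S (\<lambda>x. Re (csqrt (of_real (f x))))"
    by (intro smooth_intros assms) (use assms in force)
qed (use assms in \<open>auto simp: less_imp_le\<close>)

lemma smooth_on_open_norm [smooth_intros]:
  assumes "smooth_on_open S f" "\<And>x. x \<in> S \<Longrightarrow> f x \<noteq> 0"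
  shows "smooth_on_open S (\<lambda>x. norm (f x))"
  unfolding norm_eq_sqrt_inner by (intro smooth_intros assms) (use assms in auto)

lemma smooth_mapI: "smooth_on_open T f \<Longrightarrow> X \<subseteq> T \<Longrightarrow> smooth_map X f"
  unfolding smooth_map_def by blast

lemma smooth_map_has_derivative:
  assumes "smooth_map X f" "open X" "x \<in> X"
  obtains f' where "(f has_derivative f') (at x)"
proof -
  obtain T F where F: "x \<in> T" "smooth_on_open T F" "\<forall>y\<in>T \<inter> X. F y = f y"
    using assms unfolding smooth_map_def by blast
  have "(f has_derivative frechet_derivative F (at x)) (at x)"
    by (rule has_derivative_transform_within_open[OF smooth_on_open_has_derivative[OF F(2,1)], of "T \<inter> X"])
       (use F assms smooth_on_openD[OF F(2)] in auto)
  then show thesis by (rule that)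
qed

text \<open>With an explicit two-sided inverse \<open>\<psi>\<close> at hand,
  \<open>inv_into U x\<close> agrees with \<open>\<psi>\<close> on \<open>W\<close>, so its
  smoothness does not call for an inverse function theorem.\<close>

lemma local_coordsI:
  assumes "openin (top_of_set M) U" "p \<in> U" "x p = 0"
    and "smooth_on_open T x" "U \<subseteq> T" "smooth_on_open W \<psi>"
    and "\<And>z. z \<in> U \<Longrightarrow> x z \<in> W" "\<And>w. w \<in> W \<Longrightarrow> \<psi> w \<in> U"
    and "\<And>z. z \<in> U \<Longrightarrow> \<psi> (x z) = z" "\<And>w. w \<in> W \<Longrightarrow> x (\<psi> w) = w"
  shows "local_coords M p U x"
proof -
  have im: "x ` U = W" using assms(7,8,10) by force
  have inj: "inj_on x U" by (metis assms(9) inj_onI)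
  have inv: "inv_into U x w = \<psi> w" if "w \<in> W" for w
    by (metis assms(8,10) inj inv_into_f_f that)
  have "smooth_map W (inv_into U x)"
    by (rule smooth_mapI[OF smooth_on_open_cong[OF assms(6)]]) (use inv in auto)
  then show ?thesis
    unfolding local_coords_def im
    using assms(1-3) inj smooth_mapI[OF assms(4,5)] smooth_on_openD[OF assms(6)] by simp
qed

section \<open>Singular points\<close>

text \<open>By the chain rule every curve with velocity \<open>v\<close> yields \<open>D v\<close>,
  and membership in \<open>tangent_space\<close> supplies at least one such curve; so the definite
  description in \<open>differential\<close> denotes.\<close>

lemma differential_eq:
  assumes "(\<Phi> has_derivative D) (at p)" "v \<in> tangent_space M p"
  shows "differential M \<Phi> p v = D v"
proof -
  have *: "((\<Phi> \<circ> \<gamma>) has_vector_derivative D v) (at 0)" if "smooth_curve M p \<gamma> v" for \<gamma>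
  proof -
    have g: "(\<gamma> has_derivative (\<lambda>t. t *\<^sub>R v)) (at 0)" "\<gamma> 0 = p"
      using that by (auto simp: smooth_curve_def has_vector_derivative_def)
    have "((\<lambda>t. \<Phi> (\<gamma> t)) has_derivative (\<lambda>t. D (t *\<^sub>R v))) (at 0)"
      using has_derivative_compose[OF g(1)] assms(1) g(2) by simp
    then show ?thesis
      using linear_cmul[OF has_derivative_linear[OF assms(1)]]
      by (simp add: has_vector_derivative_def o_def)
  qed
  obtain \<gamma> where "smooth_curve M p \<gamma> v" using assms(2) by (auto simp: tangent_space_def)
  with * show ?thesis
    unfolding differential_def by (intro the_equality) (auto intro: vector_derivative_unique_at)
qed

lemma tangent_space_sphere:
  fixes p v :: "'a::euclidean_space"
  assumes "open A" "p \<in> A" "norm p = \<epsilon>" "\<epsilon> > 0" "v \<bullet> p = 0" "M = sphere 0 \<epsilon> \<inter> A"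
  shows "v \<in> tangent_space M p"
proof -
  \<comment> \<open>The line through \<open>p\<close> in direction \<open>v\<close> is projected
    radially back to the sphere; since \<open>v\<close> is orthogonal to \<open>p\<close>, the
    factor \<open>\<phi>\<close> is even in \<open>t\<close> and does not change the velocity at
    0.\<close>
  define \<phi> where "\<phi> t = \<epsilon> / sqrt (\<epsilon>\<^sup>2 + t\<^sup>2 * (v \<bullet> v))" for t :: real
  define \<gamma> where "\<gamma> t = \<phi> t *\<^sub>R (p + t *\<^sub>R v)" for t
  have pos: "\<epsilon>\<^sup>2 + t\<^sup>2 * (v \<bullet> v) > 0" for t :: real
    using assms by (simp add: add_pos_nonneg)
  have pp: "p \<bullet> p = \<epsilon>\<^sup>2" using assms(3) by (simp add: dot_square_norm)
  have "(norm (p + t *\<^sub>R v))\<^sup>2 = \<epsilon>\<^sup>2 + t\<^sup>2 * (v \<bullet> v)" for t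
    unfolding power2_norm_eq_inner using assms(5) pp
    by (simp add: inner_add_left inner_add_right inner_commute power2_eq_square)
  then have n: "norm (p + t *\<^sub>R v) = sqrt (\<epsilon>\<^sup>2 + t\<^sup>2 * (v \<bullet> v))" for t
    by (metis norm_ge_zero real_sqrt_unique)
  have on: "\<gamma> t \<in> sphere 0 \<epsilon>" for t
    using real_sqrt_gt_zero[OF pos[of t]] assms(4) by (simp add: \<gamma>_def n \<phi>_def)
  have sm: "smooth_on_open UNIV \<gamma>"
    unfolding \<gamma>_def \<phi>_def
    by (intro smooth_intros open_UNIV) (use pos in \<open>auto simp: less_imp_neq[symmetric]\<close>)
  have "open (\<gamma> -` A)"
    using smooth_on_open_continuous_on[OF sm] assms(1) by (simp add: continuous_on_open_vimage)
  moreover have g0: "\<gamma> 0 = p" using assms(4) by (simp add: \<gamma>_def \<phi>_def)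
  ultimately obtain e where e: "e > 0" "ball 0 e \<subseteq> \<gamma> -` A"
    using assms(2) by (metis open_contains_ball vimageI)
  have "{-e<..<e} = ball 0 e" by (simp add: ball_eq_greaterThanLessThan)
  then have "\<gamma> ` {-e<..<e} \<subseteq> M" using on e(2) assms(6) by blast
  moreover have "smooth_on_open {-e<..<e} \<gamma>" by (rule smooth_on_open_subset[OF sm]) auto
  moreover have "(\<gamma> has_vector_derivative v) (at 0)"
  proof -
    have "(\<phi> has_real_derivative 0) (at 0)"
      unfolding \<phi>_def using assms(4) by (auto intro!: derivative_eq_intros)
    then show ?thesis unfolding \<gamma>_def
      using assms(4) by (auto intro!: derivative_eq_intros simp: \<phi>_def)
  qed
  ultimately show ?thesis unfolding tangent_space_def smooth_curve_def using e(1) g0 by auto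
qed

text \<open>The real part of the logarithmic derivative \<open>F' v / F p\<close> is the relative
  change of the modulus, which the normalisation removes. The imaginary part is the angular velocity
  on the circle.\<close>

lemma has_derivative_sgn_complex:
  fixes F :: "'a::real_normed_vector \<Rightarrow> complex"
  assumes "(F has_derivative F') (at p)" "F p \<noteq> 0"
  shows "((\<lambda>z. F z / of_real (cmod (F z))) has_derivative
     (\<lambda>v. Im (F' v / F p) *\<^sub>R (\<i> * (F p / of_real (cmod (F p)))))) (at p)"
proof -
  have nd: "((\<lambda>z. norm (F z)) has_derivative (\<lambda>v. F' v \<bullet> sgn (F p))) (at p)"
    using has_derivative_compose[OF assms(1) has_derivative_norm[OF assms(2)]] by simp
  have *: "(F' v * of_real (cmod (F p)) - F p * of_real (F' v \<bullet> sgn (F p))) / (of_real (cmod (F p)) * of_real (cmod (F p)))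
     = Im (F' v / F p) *\<^sub>R (\<i> * (F p / of_real (cmod (F p))))" for v
  proof -
    define q where "q = F' v / F p"
    have q: "F' v = q * F p" using assms(2) by (simp add: q_def)
    have n: "of_real (cmod (F p)) * of_real (cmod (F p)) = F p * cnj (F p)"
      using complex_norm_square[of "F p"] by (simp add: power2_eq_square)
    have "F' v \<bullet> F p = Re q * (F p \<bullet> F p)"
      unfolding q by (simp add: inner_complex_def algebra_simps)
    then have "F' v \<bullet> sgn (F p) = Re q * cmod (F p)"
      using assms(2) by (simp add: sgn_div_norm dot_square_norm power2_eq_square field_simps)
    then have "(F' v * of_real (cmod (F p)) - F p * of_real (F' v \<bullet> sgn (F p)))
      = F p * of_real (cmod (F p)) * (q - of_real (Re q))"
      by (simp add: q algebra_simps)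
    also have "q - of_real (Re q) = \<i> * of_real (Im q)" by (simp add: complex_eq_iff)
    finally show ?thesis using assms(2) by (simp add: q_def[symmetric] scaleR_conv_of_real field_simps)
  qed
  have "((\<lambda>z. F z / of_real (cmod (F z))) has_derivative
     (\<lambda>v. (F' v * of_real (cmod (F p)) - F p * of_real (F' v \<bullet> sgn (F p))) / (of_real (cmod (F p)) * of_real (cmod (F p))))) (at p)"
    by (rule has_derivative_divide'[OF assms(1) has_derivative_of_real[OF nd]]) (use assms(2) in simp)
  then show ?thesis unfolding * .
qed

section \<open>The two polynomials and their differentials\<close>

locale fermat_pair =
  fixes c d :: "'n::finite \<Rightarrow> complex" and m :: nat
  assumes m_ge: "m \<ge> 2"
    and c_nonzero: "c j \<noteq> 0" and d_nonzero: "d j \<noteq> 0"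
    and det_nonzero: "j \<noteq> k \<Longrightarrow> c j * d k - c k * d j \<noteq> 0"
begin

definition f :: "complex ^ 'n \<Rightarrow> complex" where "f z = (\<Sum>j\<in>UNIV. c j * (z $ j) ^ m)"
definition g :: "complex ^ 'n \<Rightarrow> complex" where "g z = (\<Sum>j\<in>UNIV. d j * (z $ j) ^ m)"

definition df :: "complex ^ 'n \<Rightarrow> complex ^ 'n \<Rightarrow> complex" where
  "df p v = (\<Sum>j\<in>UNIV. c j * (of_nat m * (p $ j) ^ (m - 1) * v $ j))"
definition dg :: "complex ^ 'n \<Rightarrow> complex ^ 'n \<Rightarrow> complex" where
  "dg p v = (\<Sum>j\<in>UNIV. d j * (of_nat m * (p $ j) ^ (m - 1) * v $ j))"

definition axis_point :: "'n \<Rightarrow> complex ^ 'n \<Rightarrow> bool" where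
  "axis_point j p \<longleftrightarrow> p $ j \<noteq> 0 \<and> (\<forall>k. k \<noteq> j \<longrightarrow> p $ k = 0)"

lemma smooth_f: "smooth_on_open UNIV f" and smooth_g: "smooth_on_open UNIV g"
  unfolding f_def[abs_def] g_def[abs_def] by (intro smooth_intros open_UNIV)+

lemma smooth_milnor_product: "smooth_on_open {z. f z * g z \<noteq> 0} (milnor_product f g)"
proof -
  have o: "open {z. f z * g z \<noteq> 0}"
    using smooth_on_open_continuous_on[OF smooth_f] smooth_on_open_continuous_on[OF smooth_g]
    by (intro open_Collect_neq continuous_intros)
  show ?thesis
    unfolding milnor_product_def[abs_def]
    by (intro smooth_intros smooth_on_open_subset[OF smooth_f] smooth_on_open_subset[OF smooth_g] o) auto
qed

lemma has_derivative_f: "(f has_derivative df p) (at p)"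
  and has_derivative_g: "(g has_derivative dg p) (at p)"
  unfolding f_def[abs_def] g_def[abs_def] df_def[abs_def] dg_def[abs_def]
  by (auto intro!: derivative_eq_intros bounded_linear_imp_has_derivative[OF bounded_linear_vec_nth]
      simp: mult_ac fun_eq_iff)

lemma has_derivative_milnor_product:
  assumes "f p \<noteq> 0" "g p \<noteq> 0"
  shows "(milnor_product f g has_derivative (\<lambda>v.
     (Im (df p v / f p) *\<^sub>R (\<i> * (f p / of_real (cmod (f p)))), Im (dg p v / g p) *\<^sub>R (\<i> * (g p / of_real (cmod (g p))))))) (at p)"
  unfolding milnor_product_def[abs_def]
  by (intro has_derivative_Pair has_derivative_sgn_complex has_derivative_f has_derivative_g assms)

lemma euler_f: "df p p = of_nat m * f p" and euler_g: "dg p p = of_nat m * g p"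
proof -
  have "x ^ m = x * x ^ (m - 1)" for x :: complex using m_ge by (cases m) auto
  then show "df p p = of_nat m * f p" "dg p p = of_nat m * g p"
    by (simp_all add: df_def dg_def f_def g_def sum_distrib_left mult_ac)
qed

lemma df_diff: "df p (v - r *\<^sub>R w) = df p v - r *\<^sub>R df p w"
  and dg_diff: "dg p (v - r *\<^sub>R w) = dg p v - r *\<^sub>R dg p w"
  using has_derivative_linear[OF has_derivative_f[of p]] has_derivative_linear[OF has_derivative_g[of p]]
  by (simp_all add: linear_diff linear_cmul)

text \<open>As \<open>m \<ge> 2\<close>, both 0^m and 0^(m-1) vanish, and only the
  \<open>j\<close>-th summand survives.\<close>

lemma axis_point_values:
  assumes "axis_point j p"
  shows "f p = c j * (p $ j) ^ m" "g p = d j * (p $ j) ^ m"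
    "df p v = c j * (of_nat m * (p $ j) ^ (m - 1) * v $ j)"
    "dg p v = d j * (of_nat m * (p $ j) ^ (m - 1) * v $ j)"
proof -
  have *: "(\<Sum>k\<in>UNIV. h k) = h j" if "\<And>k. k \<noteq> j \<Longrightarrow> h k = 0" for h :: "'n \<Rightarrow> complex"
    using sum.mono_neutral_right[of UNIV "{j}" h] that by auto
  show "f p = c j * (p $ j) ^ m" "g p = d j * (p $ j) ^ m"
    "df p v = c j * (of_nat m * (p $ j) ^ (m - 1) * v $ j)"
    "dg p v = d j * (of_nat m * (p $ j) ^ (m - 1) * v $ j)"
    unfolding f_def g_def df_def dg_def using assms m_ge
    by (intro *; auto simp: axis_point_def power_0_left)+
qed

lemma axis_point_nonzero: "axis_point j p \<Longrightarrow> f p \<noteq> 0 \<and> g p \<noteq> 0"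
  using axis_point_values c_nonzero d_nonzero by (auto simp: axis_point_def)

text \<open>The minor of \<open>c\<close> and \<open>d\<close> at two nonzero coordinates is
  invertible, so a vector supported on these two coordinates solves both equations.\<close>

lemma differentials_onto:
  assumes "j \<noteq> k" "p $ j \<noteq> 0" "p $ k \<noteq> 0"
  obtains v where "df p v = A" "dg p v = B"
proof -
  define \<Delta> where "\<Delta> = c j * d k - c k * d j"
  have \<Delta>: "\<Delta> \<noteq> 0" using det_nonzero assms(1) by (simp add: \<Delta>_def)
  \<comment> \<open>Cramer's rule for \<open>c j * X + c k * Y = A\<close> and
    \<open>d j * X + d k * Y = B\<close>; the entries of \<open>v\<close> then divide out the
    factors coming from the derivative of the \<open>m\<close>-th power.\<close>
  define X where "X = (A * d k - c k * B) / \<Delta>"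
  define Y where "Y = (c j * B - A * d j) / \<Delta>"
  define v :: "complex ^ 'n" where "v = (\<chi> i. if i = j then X / (of_nat m * (p $ j) ^ (m - 1))
     else if i = k then Y / (of_nat m * (p $ k) ^ (m - 1)) else 0)"
  have *: "(\<Sum>i\<in>UNIV. h i * (of_nat m * (p $ i) ^ (m - 1) * v $ i)) = h j * X + h k * Y" for h
  proof -
    have "(\<Sum>i\<in>UNIV. h i * (of_nat m * (p $ i) ^ (m - 1) * v $ i))
      = (\<Sum>i\<in>{j,k}. h i * (of_nat m * (p $ i) ^ (m - 1) * v $ i))"
      by (intro sum.mono_neutral_right) (auto simp: v_def)
    then show ?thesis using assms m_ge by (simp add: v_def)
  qed
  have "df p v = A" "dg p v = B"
    unfolding df_def dg_def * X_def Y_def using \<Delta>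
    by (simp_all add: field_simps) (simp_all add: \<Delta>_def algebra_simps)
  then show thesis by (rule that)
qed

section \<open>The singular points are the axis points\<close>

definition link_complement :: "real \<Rightarrow> (complex ^ 'n) set" where
  "link_complement \<epsilon> = sphere 0 \<epsilon> - milnor_link f g \<epsilon>"

lemma link_complement_eq: "link_complement \<epsilon> = sphere 0 \<epsilon> \<inter> {z. f z * g z \<noteq> 0}"
  by (auto simp: link_complement_def milnor_link_def)

text \<open>On an axis the logarithmic differentials of \<open>f\<close> and \<open>g\<close>
  coincide, so the image of the differential lies in a line. With two nonzero coordinates,
  \<open>differentials_onto\<close> prescribes both at will, and the correction that makes the
  vector tangent to the sphere is invisible to the differential.\<close>

lemma singular_point_iff:
  assumes "\<epsilon> > 0"
  shows "singular_point (link_complement \<epsilon>) (milnor_product f g) p \<longleftrightarrow> norm p = \<epsilon> \<and> (\<exists>j. axis_point j p)"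
proof (cases "p \<in> link_complement \<epsilon>")
  case False
  then show ?thesis using axis_point_nonzero by (auto simp: singular_point_def link_complement_eq)
next
  case True
  then have p: "norm p = \<epsilon>" "f p \<noteq> 0" "g p \<noteq> 0" by (auto simp: link_complement_eq)
  let ?M = "link_complement \<epsilon>" and ?\<Phi> = "milnor_product f g"
  define a b where "a = \<i> * (f p / of_real (cmod (f p)))" and "b = \<i> * (g p / of_real (cmod (g p)))"
  have ab: "a \<noteq> 0" "b \<noteq> 0" using p by (auto simp: a_def b_def)
  have D: "differential ?M ?\<Phi> p v = (Im (df p v / f p) *\<^sub>R a, Im (dg p v / g p) *\<^sub>R b)"
    if "v \<in> tangent_space ?M p" for v
    using differential_eq[OF has_derivative_milnor_product[OF p(2,3)] that] by (simp add: a_def b_def)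
  show ?thesis
  proof (cases "\<exists>j. axis_point j p")
    case j: True
    then obtain j where j: "axis_point j p" by blast
    have "differential ?M ?\<Phi> p v \<in> span {(a, b)}" if "v \<in> tangent_space ?M p" for v
    proof -
      have "(p $ j) ^ m = p $ j * (p $ j) ^ (m - 1)" using m_ge by (cases m) auto
      then have "df p v / f p = of_nat m * v $ j / p $ j" "dg p v / g p = of_nat m * v $ j / p $ j"
        unfolding axis_point_values[OF j] using c_nonzero d_nonzero j by (auto simp: axis_point_def field_simps)
      then have "differential ?M ?\<Phi> p v = Im (of_nat m * v $ j / p $ j) *\<^sub>R (a, b)"
        unfolding D[OF that] by simp
      then show ?thesis by (metis span_base span_scale singletonI)
    qed
    then have "rank_at ?M ?\<Phi> p \<le> card {(a, b)}"
      unfolding rank_at_def by (intro dim_le_card) auto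
    then show ?thesis using True p j by (auto simp: singular_point_def)
  next
    case False
    have "\<exists>j. p $ j \<noteq> 0"
    proof (rule ccontr)
      assume "\<not> ?thesis"
      then have "p = 0" by (simp add: vec_eq_iff)
      with p assms show False by simp
    qed
    then obtain j k where jk: "j \<noteq> k" "p $ j \<noteq> 0" "p $ k \<noteq> 0"
      using False unfolding axis_point_def by metis
    have img: "(Im A *\<^sub>R a, Im B *\<^sub>R b) \<in> differential ?M ?\<Phi> p ` tangent_space ?M p" for A B
    proof -
      obtain v where v: "df p v = A * f p" "dg p v = B * g p" using differentials_onto[OF jk] by blast
      \<comment> \<open>Subtracting a real multiple of \<open>p\<close> makes the vector orthogonal
        to \<open>p\<close>. By Euler's relation this changes the logarithmic differentials by real
        numbers only, so their imaginary parts stay.\<close>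
      define w where "w = v - (v \<bullet> p / (p \<bullet> p)) *\<^sub>R p"
      have "p \<bullet> p \<noteq> 0" using p assms by auto
      then have "w \<bullet> p = 0" by (simp add: w_def inner_diff_left)
      then have w: "w \<in> tangent_space ?M p"
        using tangent_space_sphere[OF smooth_on_openD[OF smooth_milnor_product], of p \<epsilon> w ?M] p assms
        by (simp add: link_complement_eq)
      have "Im (df p w / f p) = Im A" "Im (dg p w / g p) = Im B"
        unfolding w_def df_diff dg_diff euler_f euler_g v using p(2,3)
        by (simp_all add: diff_divide_distrib scaleR_conv_of_real)
      then show ?thesis using D[OF w] w by (metis image_eqI)
    qed
    have "independent {(a, 0), (0, b)}"
      using ab by (auto simp: independent_insert span_singleton zero_prod_def)
    moreover have "{(a, 0), (0, b)} \<subseteq> differential ?M ?\<Phi> p ` tangent_space ?M p"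
      using img[of \<i> 0] img[of 0 \<i>] by simp
    ultimately have "card {(a, 0), (0, b)} \<le> rank_at ?M ?\<Phi> p"
      unfolding rank_at_def by (intro independent_card_le_dim)
    moreover have "(a, 0) \<noteq> (0, b)" using ab by simp
    ultimately show ?thesis using False by (auto simp: singular_point_def)
  qed
qed

lemma axis_point_exists:
  assumes "\<epsilon> > 0" shows "\<exists>p. norm p = \<epsilon> \<and> (\<exists>j. axis_point j p)"
proof -
  \<comment> \<open>Here \<open>undefined\<close> is just some index; any axis would do.\<close>
  have "norm (axis (undefined::'n) (of_real \<epsilon> :: complex)) = \<epsilon>" using assms by (simp add: norm_eq_sqrt_inner inner_axis_axis inner_complex_def)
  moreover have "axis_point undefined (axis (undefined::'n) (of_real \<epsilon> :: complex))"
    using assms by (auto simp: axis_point_def axis_def)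
  ultimately show ?thesis by blast
qed

end

section \<open>The case \<open>m > 2\<close>\<close>

text \<open>Stated as a limit in \<open>s\<close>, so that \<open>s\<^sup>2\<close> can be
  substituted for \<open>s\<close> later.\<close>

lemma has_derivative_quotient_tendsto:
  fixes k :: "'a::real_normed_vector \<Rightarrow> 'b::real_normed_vector"
  assumes "(k has_derivative K) (at 0)" "k 0 = 0"
  shows "((\<lambda>s. k (s *\<^sub>R w) /\<^sub>R s) \<longlongrightarrow> K w) (at 0)"
proof -
  have "((\<lambda>s. s *\<^sub>R w) has_derivative (\<lambda>s. s *\<^sub>R w)) (at (0::real))"
    by (auto intro!: derivative_eq_intros)
  then have "((\<lambda>s. k (s *\<^sub>R w)) has_derivative (\<lambda>s. K (s *\<^sub>R w))) (at 0)"
    by (rule has_derivative_compose) (use assms(1) in simp)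
  then have "((\<lambda>s. norm (k (s *\<^sub>R w) - K (s *\<^sub>R w)) / norm s) \<longlongrightarrow> 0) (at 0)"
    using assms(2) by (simp add: has_derivative_at)
  moreover have "norm (k (s *\<^sub>R w) - K (s *\<^sub>R w)) / norm s = norm (k (s *\<^sub>R w) /\<^sub>R s - K w)" if "s \<noteq> 0" for s
  proof -
    have "k (s *\<^sub>R w) /\<^sub>R s - K w = (k (s *\<^sub>R w) - K (s *\<^sub>R w)) /\<^sub>R s"
      using that linear_cmul[OF has_derivative_linear[OF assms(1)]] by (simp add: scaleR_right_diff_distrib)
    then show ?thesis by (simp add: divide_inverse_commute)
  qed
  then have "\<forall>\<^sub>F s in at 0. norm (k (s *\<^sub>R w) - K (s *\<^sub>R w)) / norm s = norm (k (s *\<^sub>R w) /\<^sub>R s - K w)"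
    by (simp add: eventually_at_filter)
  ultimately have "((\<lambda>s. norm (k (s *\<^sub>R w) /\<^sub>R s - K w)) \<longlongrightarrow> 0) (at 0)"
    by (rule Lim_transform_eventually)
  then show ?thesis using Lim_null tendsto_norm_zero_iff by blast
qed

text \<open>On the torus this is the sine of the difference between the two angles by which
  \<open>u\<close> is rotated away from \<open>w\<close>. Unlike a difference of arguments it has no
  branch cut.\<close>

definition phase_difference :: "complex \<times> complex \<Rightarrow> complex \<times> complex \<Rightarrow> real" where
  "phase_difference w u = Im (snd u / snd w * cnj (fst u / fst w))"

context fermat_pair
begin

text \<open>After division by their values at \<open>p\<close>, both polynomials have the same
  leading part \<open>Z\<close> along the curve. The rests \<open>A\<close> and \<open>B\<close>
  consist of \<open>m\<close>-th powers of coordinates that vanish at \<open>p\<close>, hence are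
  o(s^2) for \<open>m > 2\<close>.\<close>

lemma phase_difference_flat:
  fixes \<gamma> :: "real \<Rightarrow> complex ^ 'n"
  assumes p: "axis_point j p" and m: "m > 2"
    and \<gamma>: "(\<gamma> has_vector_derivative v) (at 0)" "\<gamma> 0 = p"
  shows "((\<lambda>s. phase_difference (milnor_product f g p) (milnor_product f g (\<gamma> s)) / s\<^sup>2) \<longlongrightarrow> 0) (at 0)"
proof -
  define A B Z where "A s = (\<Sum>k\<in>UNIV-{j}. c k * (\<gamma> s $ k) ^ m) / f p"
    and "B s = (\<Sum>k\<in>UNIV-{j}. d k * (\<gamma> s $ k) ^ m) / g p"
    and "Z s = (\<gamma> s $ j / p $ j) ^ m" for s
  have pj: "p $ j \<noteq> 0" "\<And>k. k \<noteq> j \<Longrightarrow> p $ k = 0" using p by (auto simp: axis_point_def)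
  have nz: "f p \<noteq> 0" "g p \<noteq> 0" using axis_point_nonzero[OF p] by auto
  have F: "f (\<gamma> s) / f p = Z s + A s" for s
    using nz c_nonzero pj unfolding f_def[of "\<gamma> s"] Z_def A_def
    by (subst sum.remove[of _ j]) (auto simp: add_divide_distrib axis_point_values[OF p] power_divide)
  have G: "g (\<gamma> s) / g p = Z s + B s" for s
    using nz d_nonzero pj unfolding g_def[of "\<gamma> s"] Z_def B_def
    by (subst sum.remove[of _ j]) (auto simp: add_divide_distrib axis_point_values[OF p] power_divide)
  have cont: "(\<gamma> \<longlongrightarrow> p) (at 0)"
    using has_vector_derivative_continuous[OF \<gamma>(1)] \<gamma>(2) by (simp add: isCont_def)
  have quot: "((\<lambda>s. \<gamma> s $ k / of_real s) \<longlongrightarrow> v $ k) (at 0)" if "k \<noteq> j" for k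
  proof -
    have "((\<lambda>s. \<gamma> s $ k) has_derivative (\<lambda>s. s *\<^sub>R v $ k)) (at 0)"
      using bounded_linear.has_derivative[OF bounded_linear_vec_nth[of k] \<gamma>(1)[unfolded has_vector_derivative_def]]
      by simp
    from has_derivative_quotient_tendsto[OF this, of 1] show ?thesis
      using \<gamma>(2) pj(2)[OF that] by (simp add: scaleR_conv_of_real divide_inverse_commute)
  qed
  \<comment> \<open>Two of the \<open>m\<close> factors absorb the division by s^2 and converge; the
    remaining \<open>m - 2 > 0\<close> factors tend to \<open>p $ k = 0\<close>.\<close>
  have pow: "((\<lambda>s. h * (\<gamma> s $ k) ^ m / of_real (s\<^sup>2)) \<longlongrightarrow> 0) (at 0)" if "k \<noteq> j" for k h
  proof -
    have "((\<lambda>s. h * (\<gamma> s $ k / of_real s)\<^sup>2 * (\<gamma> s $ k) ^ (m - 2)) \<longlongrightarrow> h * (v $ k)\<^sup>2 * (p $ k) ^ (m - 2)) (at 0)"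
      by (intro tendsto_intros quot that cont)
    moreover have "x ^ m = x\<^sup>2 * x ^ (m - 2)" for x :: complex
    proof -
      have "m = 2 + (m - 2)" using m by simp
      then show ?thesis by (metis power_add)
    qed
    ultimately show ?thesis using m pj(2)[OF that] by (simp add: power_divide mult.assoc power_0_left)
  qed
  have A2: "((\<lambda>s. A s / of_real (s\<^sup>2)) \<longlongrightarrow> 0) (at 0)"
  proof -
    have "((\<lambda>s. (\<Sum>k\<in>UNIV-{j}. c k * (\<gamma> s $ k) ^ m / of_real (s\<^sup>2)) / f p) \<longlongrightarrow> (\<Sum>k\<in>UNIV-{j}. 0) / f p) (at 0)"
      by (intro tendsto_intros pow nz) auto
    then show ?thesis by (simp add: A_def sum_divide_distrib mult.commute)
  qed
  have B2: "((\<lambda>s. B s / of_real (s\<^sup>2)) \<longlongrightarrow> 0) (at 0)"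
  proof -
    have "((\<lambda>s. (\<Sum>k\<in>UNIV-{j}. d k * (\<gamma> s $ k) ^ m / of_real (s\<^sup>2)) / g p) \<longlongrightarrow> (\<Sum>k\<in>UNIV-{j}. 0) / g p) (at 0)"
      by (intro tendsto_intros pow nz) auto
    then show ?thesis by (simp add: B_def sum_divide_distrib mult.commute)
  qed
  have Z1: "(Z \<longlongrightarrow> 1) (at 0)"
  proof -
    have "((\<lambda>s. (\<gamma> s $ j / p $ j) ^ m) \<longlongrightarrow> (p $ j / p $ j) ^ m) (at 0)"
      by (intro tendsto_intros cont pj)
    then show ?thesis using pj by (simp add: Z_def[abs_def])
  qed
  have F1: "((\<lambda>s. f (\<gamma> s) / f p) \<longlongrightarrow> 1) (at 0)" and G1: "((\<lambda>s. g (\<gamma> s) / g p) \<longlongrightarrow> 1) (at 0)"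
  proof -
    have "isCont f p" "isCont g p"
      using smooth_on_open_continuous_on[OF smooth_f] smooth_on_open_continuous_on[OF smooth_g]
      by (auto simp: continuous_on_eq_continuous_at)
    then have "((\<lambda>s. f (\<gamma> s)) \<longlongrightarrow> f p) (at 0)" "((\<lambda>s. g (\<gamma> s)) \<longlongrightarrow> g p) (at 0)"
      using isCont_tendsto_compose[OF _ cont] by blast+
    from tendsto_divide[OF this(1) tendsto_const nz(1)] tendsto_divide[OF this(2) tendsto_const nz(2)]
    show "((\<lambda>s. f (\<gamma> s) / f p) \<longlongrightarrow> 1) (at 0)" "((\<lambda>s. g (\<gamma> s) / g p) \<longlongrightarrow> 1) (at 0)"
      using nz by simp_all
  qed
  have "((\<lambda>s. Im (Z s * cnj (A s / of_real (s\<^sup>2)) + B s / of_real (s\<^sup>2) * cnj (Z s + A s))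
      / (cmod (f (\<gamma> s) / f p) * cmod (g (\<gamma> s) / g p)))
    \<longlongrightarrow> Im (1 * cnj 0 + 0 * cnj 1) / (cmod 1 * cmod 1)) (at 0)"
    unfolding F[symmetric] by (intro tendsto_intros Z1 A2 B2 F1 G1) auto
  \<comment> \<open>The equation holds for all \<open>s\<close>: if \<open>s = 0\<close> or if
    \<open>f\<close> or \<open>g\<close> vanishes on the curve, both sides are 0 by the convention
    x/0 = 0.\<close>
  moreover have "phase_difference (milnor_product f g p) (milnor_product f g (\<gamma> s)) / s\<^sup>2
    = Im (Z s * cnj (A s / of_real (s\<^sup>2)) + B s / of_real (s\<^sup>2) * cnj (Z s + A s))
      / (cmod (f (\<gamma> s) / f p) * cmod (g (\<gamma> s) / g p))" for s
  proof -
    have "Im (Z s * cnj (A s / of_real (s\<^sup>2)) + B s / of_real (s\<^sup>2) * cnj (Z s + A s))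
      = Im ((Z s * cnj (A s) + B s * cnj (Z s + A s)) / of_real (s\<^sup>2))"
      by (simp add: add_divide_distrib)
    also have "\<dots> = Im (Z s * cnj (A s) + B s * cnj (Z s + A s)) / s\<^sup>2" by (rule Im_divide_of_real)
    \<comment> \<open>The two sides differ by \<open>Z s * cnj (Z s)\<close>, which is real.\<close>
    also have "Im (Z s * cnj (A s) + B s * cnj (Z s + A s)) = Im ((Z s + B s) * cnj (Z s + A s))"
      by (simp add: algebra_simps)
    finally have 1: "Im (Z s * cnj (A s / of_real (s\<^sup>2)) + B s / of_real (s\<^sup>2) * cnj (Z s + A s))
      = Im (g (\<gamma> s) / g p * cnj (f (\<gamma> s) / f p)) / s\<^sup>2" by (simp add: F G)
    have "phase_difference (milnor_product f g p) (milnor_product f g (\<gamma> s))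
      = Im (g (\<gamma> s) / g p * cnj (f (\<gamma> s) / f p) / of_real (cmod (f (\<gamma> s) / f p) * cmod (g (\<gamma> s) / g p)))"
      using nz by (simp add: phase_difference_def milnor_product_def norm_divide field_simps)
    then show ?thesis unfolding 1 Im_divide_of_real by simp
  qed
  ultimately show ?thesis by simp
qed

text \<open>A fold chart would carry the flatness of the phase difference over to the torus: its
  expression \<open>k\<close> in the target coordinates would have derivative \<open>K = 0\<close>
  at 0. Rotating the second circle alone shows that it does not.\<close>

lemma not_fold_point:
  assumes "\<epsilon> > 0" "m > 2" "CARD('n) \<ge> 2"
  shows "\<not> fold_point (link_complement \<epsilon>) torus (milnor_product f g) p"
proof
  let ?M = "link_complement \<epsilon>" and ?\<Phi> = "milnor_product f g" and ?n = "CARD('n)"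
  assume fold: "fold_point ?M torus ?\<Phi> p"
  then obtain U and x :: "complex ^ 'n \<Rightarrow> real ^ 'n cidx" and V and y :: "complex \<times> complex \<Rightarrow> real \<times> real" and l
    where x: "local_coords ?M p U x" and y: "local_coords torus (?\<Phi> p) V y"
      and UV: "?\<Phi> ` U \<subseteq> V" and l: "l \<le> 2 * ?n - 2"
      and nf: "\<And>q. q \<in> U \<Longrightarrow> y (?\<Phi> q) = (coord (x q) (2 * ?n - 1),
         - (\<Sum>i = 1..l. (coord (x q) i)\<^sup>2) + (\<Sum>i = l + 1..2 * ?n - 2. (coord (x q) i)\<^sup>2))"
    unfolding fold_point_def by (auto simp: prod_eq_iff)
  from fold obtain j where j: "axis_point j p"
    using singular_point_iff[OF assms(1)] by (auto simp: fold_point_def)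
  define w0 where "w0 = ?\<Phi> p"
  have w0: "norm (fst w0) = 1" "norm (snd w0) = 1"
    using axis_point_nonzero[OF j] by (auto simp: w0_def milnor_product_def norm_divide)
  define \<xi> R where "\<xi> = inv_into U x" and "R = inv_into V y"
  have xD: "p \<in> U" "open (x ` U)" "inj_on x U" "smooth_map (x ` U) \<xi>" "x p = 0"
    using x by (auto simp: local_coords_def \<xi>_def)
  have yD: "openin (top_of_set torus) V" "w0 \<in> V" "open (y ` V)" "inj_on y V" "smooth_map V y"
      "smooth_map (y ` V) R" "y w0 = 0"
    using y by (auto simp: local_coords_def R_def w0_def)
  have x0: "0 \<in> x ` U" "\<xi> 0 = p" using xD inv_into_f_f[of x U p] by (auto simp: \<xi>_def image_iff)
  have y0: "0 \<in> y ` V" "R 0 = w0" using yD inv_into_f_f[of y V w0] by (auto simp: R_def image_iff)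
  obtain \<xi>' where \<xi>': "(\<xi> has_derivative \<xi>') (at 0)" using smooth_map_has_derivative[OF xD(4,2) x0(1)] .
  obtain R' where R': "(R has_derivative R') (at 0)" using smooth_map_has_derivative[OF yD(6,3) y0(1)] .
  define k where "k s = phase_difference w0 (R s)" for s
  have k0: "k 0 = 0" using w0 by (auto simp: k_def y0 phase_difference_def complex_mult_cnj)
  obtain K where K: "(k has_derivative K) (at 0)"
  proof -
    have "((\<lambda>s. Im (snd (R s) / snd w0 * cnj (fst (R s) / fst w0))) has_derivative
      (\<lambda>h. Im (snd (R 0) / snd w0 * cnj (fst (R' h) / fst w0) + snd (R' h) / snd w0 * cnj (fst (R 0) / fst w0)))) (at 0)"
      unfolding divide_inverse
      by (intro bounded_linear.has_derivative[OF bounded_linear_Im] has_derivative_mult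
        bounded_linear.has_derivative[OF bounded_linear_cnj] has_derivative_mult_left
        bounded_linear.has_derivative[OF bounded_linear_fst] bounded_linear.has_derivative[OF bounded_linear_snd] R')
    then show thesis using that unfolding k_def phase_difference_def by blast
  qed
  have curve: "((\<lambda>s. k (y (?\<Phi> (\<xi> (s *\<^sub>R w)))) / s\<^sup>2) \<longlongrightarrow> 0) (at 0)"
    and inU: "\<forall>\<^sub>F s in at 0. \<xi> (s *\<^sub>R w) \<in> U \<and> x (\<xi> (s *\<^sub>R w)) = s *\<^sub>R w" for w
  proof -
    have lim: "((\<lambda>s. s *\<^sub>R w) \<longlongrightarrow> 0) (at (0::real))"
      by (auto intro!: tendsto_eq_intros)
    have "\<forall>\<^sub>F s in at 0. s *\<^sub>R w \<in> x ` U"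
      using topological_tendstoD[OF lim xD(2) x0(1)] .
    then show inU: "\<forall>\<^sub>F s in at 0. \<xi> (s *\<^sub>R w) \<in> U \<and> x (\<xi> (s *\<^sub>R w)) = s *\<^sub>R w"
      by eventually_elim (auto simp: \<xi>_def inv_into_into f_inv_into_f)
    have "((\<lambda>s. \<xi> (s *\<^sub>R w)) has_vector_derivative \<xi>' w) (at 0)"
    proof -
      have "((\<lambda>s. s *\<^sub>R w) has_derivative (\<lambda>s. s *\<^sub>R w)) (at (0::real))"
        by (auto intro!: derivative_eq_intros)
      then have "((\<lambda>s. \<xi> (s *\<^sub>R w)) has_derivative (\<lambda>s. \<xi>' (s *\<^sub>R w))) (at 0)"
        by (rule has_derivative_compose) (use \<xi>' in simp)
      then show ?thesis
        using linear_cmul[OF has_derivative_linear[OF \<xi>']] by (simp add: has_vector_derivative_def)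
    qed
    from phase_difference_flat[OF j assms(2) this]
    have "((\<lambda>s. phase_difference w0 (?\<Phi> (\<xi> (s *\<^sub>R w))) / s\<^sup>2) \<longlongrightarrow> 0) (at 0)"
      using x0 by (simp add: w0_def)
    moreover have "\<forall>\<^sub>F s in at 0. phase_difference w0 (?\<Phi> (\<xi> (s *\<^sub>R w))) / s\<^sup>2 = k (y (?\<Phi> (\<xi> (s *\<^sub>R w)))) / s\<^sup>2"
      using inU
    proof eventually_elim
      case (elim s)
      then have "?\<Phi> (\<xi> (s *\<^sub>R w)) \<in> V" using UV by blast
      then show ?case by (simp add: k_def R_def inv_into_f_f[OF yD(4)])
    qed
    ultimately show "((\<lambda>s. k (y (?\<Phi> (\<xi> (s *\<^sub>R w)))) / s\<^sup>2) \<longlongrightarrow> 0) (at 0)"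
      by (rule Lim_transform_eventually)
  qed
  have coord: "coord (s *\<^sub>R axis (Abs_cidx i) 1 :: real ^ 'n cidx) i' = (if i' = i then s else 0)"
    if "i \<in> {1..2 * ?n - 1}" "i' \<in> {1..2 * ?n - 1}" for i i' and s :: real
    using that Abs_cidx_inject[OF that] by (auto simp: coord_def axis_def)
  \<comment> \<open>Along the last coordinate axis the fold formula reads \<open>(s, 0)\<close>.
    There \<open>k\<close> is o(s^2), so its quotient by \<open>s\<close> tends to 0.\<close>
  have "K (1, 0) = 0"
  proof (rule tendsto_unique)
    let ?w = "axis (Abs_cidx (2 * ?n - 1)) 1 :: real ^ 'n cidx"
    show "((\<lambda>s. k (s *\<^sub>R (1, 0)) /\<^sub>R s) \<longlongrightarrow> K (1, 0)) (at 0)"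
      by (rule has_derivative_quotient_tendsto[OF K k0])
    have "((\<lambda>s. s * (k (y (?\<Phi> (\<xi> (s *\<^sub>R ?w)))) / s\<^sup>2)) \<longlongrightarrow> 0 * 0) (at 0)"
      by (intro tendsto_mult curve tendsto_ident_at)
    moreover have "\<forall>\<^sub>F s in at 0. s * (k (y (?\<Phi> (\<xi> (s *\<^sub>R ?w)))) / s\<^sup>2) = k (s *\<^sub>R (1, 0)) /\<^sub>R s"
      using inU[of ?w]
    proof eventually_elim
      case (elim s)
      have "(\<Sum>i = 1..l. (coord (s *\<^sub>R ?w) i)\<^sup>2) = 0" "(\<Sum>i = l + 1..2 * ?n - 2. (coord (s *\<^sub>R ?w) i)\<^sup>2) = 0"
        using l assms(3) by (auto intro!: sum.neutral simp: coord)
      moreover have "coord (s *\<^sub>R ?w) (2 * ?n - 1) = s" using assms(3) by (subst coord) auto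
      ultimately have "y (?\<Phi> (\<xi> (s *\<^sub>R ?w))) = (s, 0)" using nf[of "\<xi> (s *\<^sub>R ?w)"] elim by simp
      then show ?case by (cases "s = 0") (simp_all add: power2_eq_square divide_inverse)
    qed
    ultimately have "((\<lambda>s. k (s *\<^sub>R (1, 0)) /\<^sub>R s) \<longlongrightarrow> 0 * 0) (at 0)"
      by (rule Lim_transform_eventually)
    then show "((\<lambda>s. k (s *\<^sub>R (1, 0)) /\<^sub>R s) \<longlongrightarrow> 0) (at 0)" by simp
  qed simp
  moreover have "K (0, 1) = 0"
  proof -
    let ?w = "axis (Abs_cidx 1) 1 :: real ^ 'n cidx"
    \<comment> \<open>As \<open>2 * ?n - 2\<close> is at least 2, coordinate 1 is one of the
      quadratic ones; its square carries the sign minus exactly when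
      \<open>l \<ge> 1\<close>.\<close>
    define \<sigma> :: real where "\<sigma> = (if l \<ge> 1 then -1 else 1)"
    have "K (0, \<sigma>) = 0"
    proof (rule tendsto_unique)
      \<comment> \<open>The fold formula reaches the second target direction at speed s^2, so the
        difference quotient for \<open>K\<close> is taken at s^2, which tends to 0 through nonzero
        values.\<close>
      have sq: "filterlim (\<lambda>s::real. s\<^sup>2) (at 0) (at 0)"
        by (auto simp: filterlim_at eventually_at_filter intro!: tendsto_eq_intros)
      show "((\<lambda>s. k (s\<^sup>2 *\<^sub>R (0, \<sigma>)) /\<^sub>R s\<^sup>2) \<longlongrightarrow> K (0, \<sigma>)) (at 0)"
        by (rule filterlim_compose[OF has_derivative_quotient_tendsto[OF K k0] sq])
      have "\<forall>\<^sub>F s in at 0. k (y (?\<Phi> (\<xi> (s *\<^sub>R ?w)))) / s\<^sup>2 = k (s\<^sup>2 *\<^sub>R (0, \<sigma>)) /\<^sub>R s\<^sup>2"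
        using inU[of ?w]
      proof eventually_elim
        case (elim s)
        have "(\<Sum>i = 1..l. (coord (s *\<^sub>R ?w) i)\<^sup>2) = (\<Sum>i = 1..l. if i = 1 then s\<^sup>2 else 0)"
          using l assms(3) by (intro sum.cong refl) (subst coord, auto)
        moreover have "(\<Sum>i = l + 1..2 * ?n - 2. (coord (s *\<^sub>R ?w) i)\<^sup>2)
            = (\<Sum>i = l + 1..2 * ?n - 2. if i = 1 then s\<^sup>2 else 0)"
          using l assms(3) by (intro sum.cong refl) (subst coord, auto)
        moreover have "coord (s *\<^sub>R ?w) (2 * ?n - 1) = 0" using assms(3) by (subst coord) auto
        ultimately have "y (?\<Phi> (\<xi> (s *\<^sub>R ?w))) = (0, s\<^sup>2 * \<sigma>)"
          using nf[of "\<xi> (s *\<^sub>R ?w)"] elim l assms(3) by (simp add: \<sigma>_def)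
        then show ?case by (simp add: divide_inverse_commute)
      qed
      then show "((\<lambda>s. k (s\<^sup>2 *\<^sub>R (0, \<sigma>)) /\<^sub>R s\<^sup>2) \<longlongrightarrow> 0) (at 0)"
        by (rule Lim_transform_eventually[OF curve])
    qed simp
    moreover have "K (0, \<sigma>) = \<sigma> * K (0, 1)"
      using linear_cmul[OF has_derivative_linear[OF K], of \<sigma> "(0, 1)"] by simp
    ultimately show ?thesis by (simp add: \<sigma>_def split: if_splits)
  qed
  ultimately have Kz: "K h = 0" for h
    using linear_add[OF has_derivative_linear[OF K], of "(fst h, 0)" "(0, snd h)"]
      linear_cmul[OF has_derivative_linear[OF K], of "fst h" "(1, 0)"]
      linear_cmul[OF has_derivative_linear[OF K], of "snd h" "(0, 1)"] by simp
  \<comment> \<open>This curve on the torus turns only the second circle; along it the phase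
    difference from \<open>w0\<close> is \<open>sin t\<close>, with derivative 1 at 0.\<close>
  define \<tau> where "\<tau> t = (fst w0, snd w0 * cis t)" for t
  have \<tau>0: "\<tau> 0 = w0" by (simp add: \<tau>_def)
  have \<tau>': "(\<tau> has_derivative (\<lambda>t. (0, snd w0 * (t *\<^sub>R (\<i> * cis 0))))) (at 0)"
    unfolding \<tau>_def[abs_def] by (auto intro!: derivative_eq_intros)
  \<comment> \<open>The chart \<open>y\<close> lives on a subset of the torus; differentiating along
    \<open>\<tau>\<close> uses a smooth extension \<open>E\<close> to the ambient space.\<close>
  obtain T E where E: "w0 \<in> T" "smooth_on_open T E" "\<forall>q\<in>T \<inter> V. E q = y q"
    using yD(5,2) unfolding smooth_map_def by blast
  obtain O' where O': "open O'" "V = torus \<inter> O'" using yD(1) by (auto simp: openin_open)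
  have E0: "E w0 = 0" using E yD by auto
  have "((\<lambda>t. E (\<tau> t)) has_derivative (\<lambda>t. frechet_derivative E (at w0) (0, snd w0 * (t *\<^sub>R (\<i> * cis 0))))) (at 0)"
    using has_derivative_compose[OF \<tau>', of E] smooth_on_open_has_derivative[OF E(2,1)] \<tau>0 by simp
  then have "((\<lambda>t. k (E (\<tau> t))) has_derivative (\<lambda>t. K (frechet_derivative E (at w0) (0, snd w0 * (t *\<^sub>R (\<i> * cis 0)))))) (at 0)"
    by (rule has_derivative_compose) (use K \<tau>0 E0 in simp)
  then have d0: "((\<lambda>t. k (E (\<tau> t))) has_derivative (\<lambda>t. 0)) (at 0)" by (simp add: Kz)
  have "open (T \<inter> O')" using O'(1) smooth_on_openD[OF E(2)] by auto
  moreover have "(\<tau> \<longlongrightarrow> w0) (at 0)"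
    using has_derivative_continuous[OF \<tau>'] \<tau>0 by (simp add: isCont_def)
  moreover have "w0 \<in> T \<inter> O'" using E(1) yD(2) O' by auto
  ultimately have "\<forall>\<^sub>F t in at 0. \<tau> t \<in> T \<inter> O'" by (metis topological_tendstoD)
  then have ev: "\<forall>\<^sub>F t in at 0. k (E (\<tau> t)) = sin t"
  proof eventually_elim
    case (elim t)
    have "\<tau> t \<in> torus" using w0 by (simp add: \<tau>_def torus_def norm_mult)
    then have "\<tau> t \<in> T \<inter> V" using elim O' by auto
    then have "k (E (\<tau> t)) = phase_difference w0 (\<tau> t)"
      using E(3) by (simp add: k_def R_def inv_into_f_f[OF yD(4)])
    also have "\<dots> = sin t" using w0 by (auto simp: phase_difference_def \<tau>_def)
    finally show ?case .
  qed
  have "((\<lambda>t. k (E (\<tau> t)) - sin t) has_derivative (\<lambda>t. 0 - t)) (at 0)"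
    by (rule has_derivative_diff[OF d0]) (auto intro!: derivative_eq_intros)
  \<comment> \<open>The difference vanishes identically near 0, yet its derivative is
    \<open>- t\<close>: a contradiction.\<close>
  then have "((\<lambda>t. 0::real) has_derivative (\<lambda>t. 0 - t)) (at 0)"
    by (rule has_derivative_transform_eventually) (use ev E0 k0 \<tau>0 in \<open>auto elim: eventually_mono\<close>)
  from has_derivative_unique[OF this has_derivative_const] show False
    by (metis diff_0 neg_equal_0_iff_equal zero_neq_one)
qed

end

section \<open>The case \<open>m = 2\<close>\<close>

lemma Re_csqrt_pos: "w \<notin> \<real>\<^sub>\<le>\<^sub>0 \<Longrightarrow> Re (csqrt w) > 0"
proof (rule ccontr)
  assume w: "w \<notin> \<real>\<^sub>\<le>\<^sub>0" and "\<not> Re (csqrt w) > 0"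
  then have "Re (csqrt w) = 0" using csqrt_principal[of w] by auto
  then have "(csqrt w)\<^sup>2 = - of_real ((Im (csqrt w))\<^sup>2)"
    by (simp add: complex_eq_iff power2_eq_square)
  then have "w = of_real (- (Im (csqrt w))\<^sup>2)" by simp
  then show False using w by (metis nonpos_Reals_of_real_iff neg_le_0_iff_le zero_le_power2)
qed

lemma square_notin_nonpos_Reals: "Re w > 0 \<Longrightarrow> w\<^sup>2 \<notin> \<real>\<^sub>\<le>\<^sub>0"
  by (auto simp: complex_nonpos_Reals_iff power2_eq_square mult_le_0_iff)

text \<open>Positive real part singles out the principal root; explicit square roots are recognised
  in this way below.\<close>

lemma csqrt_eqI: "w\<^sup>2 = z \<Longrightarrow> Re w > 0 \<Longrightarrow> csqrt z = w"
  by (intro csqrt_unique) auto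

lemma norm_vec_cmult: "norm (\<chi> k. \<alpha> * x $ k) = cmod \<alpha> * norm x" for x :: "complex ^ 'n"
  by (simp add: norm_vec_def norm_mult L2_set_right_distrib)

section \<open>Slopes, directions and a chart of the torus\<close>

definition slope :: "complex \<Rightarrow> real" where "slope w = Im w / Re w"

text \<open>The slope is the tangent of the argument, and \<open>direction\<close> inverts it on the
  open right half of the unit circle, without an arctangent.\<close>

definition direction :: "real \<Rightarrow> complex" where
  "direction t = (1 + \<i> * of_real t) / of_real (sqrt (1 + t\<^sup>2))"

lemma one_plus_square: "1 + t\<^sup>2 \<noteq> (0::real)" "1 + t\<^sup>2 > (0::real)"
  using zero_le_power2[of t] by linarith+

lemma Re_direction: "Re (direction t) = 1 / sqrt (1 + t\<^sup>2)"
  and Im_direction: "Im (direction t) = t / sqrt (1 + t\<^sup>2)"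
  by (simp_all add: direction_def Re_divide_of_real Im_divide_of_real)

lemma norm_direction: "norm (direction t) = 1"
proof -
  have "(cmod (direction t))\<^sup>2 = (1 + t\<^sup>2) / (sqrt (1 + t\<^sup>2))\<^sup>2"
    unfolding cmod_power2 Re_direction Im_direction power_divide by (simp only: add_divide_distrib power_one)
  also have "(sqrt (1 + t\<^sup>2))\<^sup>2 = 1 + t\<^sup>2" by simp
  also have "(1 + t\<^sup>2) / (1 + t\<^sup>2) = 1" using one_plus_square[of t] by simp
  finally show ?thesis by (metis norm_ge_zero power2_eq_1_iff zero_le_one neg_0_le_iff_le le_minus_one_simps(3))
qed

lemma Re_direction_pos: "Re (direction t) > 0" and slope_direction: "slope (direction t) = t"
  using one_plus_square[of t] by (simp_all add: Re_direction Im_direction slope_def)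

lemma direction_slope:
  assumes "norm w = 1" "Re w > 0" shows "direction (slope w) = w"
proof -
  have "(Re w)\<^sup>2 + (Im w)\<^sup>2 = 1" using assms(1) by (metis cmod_power2 one_power2)
  then have "1 + (slope w)\<^sup>2 = (1 / Re w)\<^sup>2"
    using assms(2) by (simp add: slope_def field_simps)
  then have "sqrt (1 + (slope w)\<^sup>2) = 1 / Re w" using assms(2) by simp
  then show ?thesis using assms(2) by (simp add: direction_def slope_def complex_eq_iff)
qed

lemma slope_mult_of_real: "r \<noteq> 0 \<Longrightarrow> slope (w * of_real r) = slope w"
  by (simp add: slope_def)

lemma smooth_direction [smooth_intros]:
  "smooth_on_open S f \<Longrightarrow> smooth_on_open S (\<lambda>x. direction (f x))"
  unfolding direction_def
  by (intro smooth_intros) (use one_plus_square in \<open>auto dest: smooth_on_openD\<close>)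

lemma smooth_slope [smooth_intros]:
  "smooth_on_open S f \<Longrightarrow> (\<And>x. x \<in> S \<Longrightarrow> Re (f x) \<noteq> 0) \<Longrightarrow> smooth_on_open S (\<lambda>x. slope (f x))"
  unfolding slope_def by (intro smooth_intros)

text \<open>The second coordinate measures the quotient of the two rotations rather than the second
  rotation, so that it becomes the slope of \<open>G/F\<close> for the map under study.\<close>

definition torus_chart :: "complex \<times> complex \<Rightarrow> complex \<times> complex \<Rightarrow> real \<times> real" where
  "torus_chart w u = (slope (fst u / fst w), slope ((snd u / snd w) / (fst u / fst w)))"

definition torus_chart_dom :: "complex \<times> complex \<Rightarrow> (complex \<times> complex) set" where
  "torus_chart_dom w = {u. Re (fst u / fst w) > 0 \<and> Re ((snd u / snd w) / (fst u / fst w)) > 0}"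

text \<open>Continuity of \<open>h'\<close> is asked for only where \<open>h\<close> is positive;
  this suits quotients whose denominator is nonzero there.\<close>

lemma open_Collect_pos_conj:
  fixes h h' :: "'a::topological_space \<Rightarrow> real"
  assumes "open {x. h x > 0}" "continuous_on {x. h x > 0} h'"
  shows "open {x. h x > 0 \<and> h' x > 0}"
proof -
  have "open ({x. h x > 0} \<inter> h' -` {0<..})"
    by (intro continuous_open_preimage assms open_greaterThan)
  moreover have "{x. h x > 0} \<inter> h' -` {0<..} = {x. h x > 0 \<and> h' x > 0}" by auto
  ultimately show ?thesis by simp
qed

lemma open_torus_chart_dom:
  assumes "fst w \<noteq> 0" "snd w \<noteq> 0" shows "open (torus_chart_dom w)"
  unfolding torus_chart_dom_def
proof (rule open_Collect_pos_conj)
  show "open {u. 0 < Re (fst u / fst w)}"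
    by (intro open_Collect_less continuous_intros) (use assms in auto)
  show "continuous_on {u. 0 < Re (fst u / fst w)} (\<lambda>u. Re (snd u / snd w / (fst u / fst w)))"
    by (intro continuous_intros) (use assms in auto)
qed

text \<open>Since the second coordinate records a quotient, the inverse \<open>\<psi>\<close> turns
  \<open>snd w\<close> by the product of both directions.\<close>

lemma local_coords_torus_chart:
  assumes w: "w \<in> torus"
  shows "local_coords torus w (torus \<inter> torus_chart_dom w) (torus_chart w)"
proof -
  have w1: "norm (fst w) = 1" "norm (snd w) = 1" using w by (auto simp: torus_def)
  then have nz: "fst w \<noteq> 0" "snd w \<noteq> 0" by auto
  note o = open_torus_chart_dom[OF nz]
  define \<psi> where "\<psi> t = (fst w * direction (fst t), snd w * (direction (fst t) * direction (snd t)))" for t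
  have dn: "direction t \<noteq> 0" for t using Re_direction_pos[of t] by auto
  show ?thesis
  proof (rule local_coordsI)
    show "openin (top_of_set torus) (torus \<inter> torus_chart_dom w)" using o by (simp add: openin_open_Int)
    show "w \<in> torus \<inter> torus_chart_dom w" using w nz by (auto simp: torus_chart_dom_def)
    show "torus_chart w w = 0" using nz by (simp add: torus_chart_def slope_def zero_prod_def)
    show "smooth_on_open (torus_chart_dom w) (torus_chart w)"
      unfolding torus_chart_def[abs_def]
      by (intro smooth_intros o) (use nz in \<open>auto simp: torus_chart_dom_def\<close>)
    show "torus \<inter> torus_chart_dom w \<subseteq> torus_chart_dom w" by simp
    show "smooth_on_open UNIV \<psi>"
      unfolding \<psi>_def[abs_def] by (intro smooth_intros open_UNIV)
    show "\<psi> t \<in> torus \<inter> torus_chart_dom w" for t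
      using w1 nz dn Re_direction_pos by (auto simp: \<psi>_def torus_def torus_chart_dom_def norm_mult norm_direction)
    show "torus_chart w (\<psi> t) = t" for t
      using nz dn by (simp add: torus_chart_def \<psi>_def slope_direction)
    show "\<psi> (torus_chart w u) = u" if u: "u \<in> torus \<inter> torus_chart_dom w" for u
    proof -
      have u1: "norm (fst u) = 1" "norm (snd u) = 1" using u by (auto simp: torus_def)
      have "direction (slope (fst u / fst w)) = fst u / fst w"
        using u w1 u1 by (intro direction_slope) (auto simp: torus_chart_dom_def norm_divide)
      moreover have "direction (slope ((snd u / snd w) / (fst u / fst w))) = (snd u / snd w) / (fst u / fst w)"
      proof (rule direction_slope)
        show "norm ((snd u / snd w) / (fst u / fst w)) = 1" unfolding norm_divide w1 u1 by simp
      qed (use u in \<open>simp add: torus_chart_dom_def\<close>)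
      moreover have "fst u \<noteq> 0" using u by (auto simp: torus_def)
      ultimately show ?thesis using nz by (simp add: \<psi>_def torus_chart_def)
    qed
  qed auto
qed

section \<open>Morse coordinates at an axis point\<close>

locale quadratic_chart = fermat_pair c d m for c d :: "'n::finite \<Rightarrow> complex" and m +
  fixes j :: 'n and p :: "complex ^ 'n"
  assumes m_eq: "m = 2" and p_axis: "axis_point j p"
begin

definition ratio :: "'n \<Rightarrow> complex" where "ratio k = d k / d j - c k / c j"
definition \<kappa> :: "'n \<Rightarrow> complex" where "\<kappa> k = csqrt (- \<i> * ratio k)"
definition F :: "complex ^ 'n \<Rightarrow> complex" where "F z = (\<Sum>k\<in>UNIV. c k / c j * (z $ k / p $ j)\<^sup>2)"
definition G :: "complex ^ 'n \<Rightarrow> complex" where "G z = (\<Sum>k\<in>UNIV. d k / d j * (z $ k / p $ j)\<^sup>2)"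
definition r :: "complex ^ 'n \<Rightarrow> real" where "r z = Re (G z / F z)"
text \<open>The last quantity fixes the sign of \<open>z $ j\<close>, which \<open>morse\<close>
  does not see. The \<open>min\<close> packs two conditions into one continuous function, as
  \<open>open_Collect_pos_conj\<close> expects.\<close>

definition chart_dom :: "(complex ^ 'n) set" where
  "chart_dom = {z. Re (F z) > 0 \<and> min (r z) (Re (z $ j / p $ j / csqrt (F z))) > 0}"
definition morse :: "complex ^ 'n \<Rightarrow> complex ^ 'n" where
  "morse z = (\<chi> k. \<kappa> k * (z $ k / p $ j) / (csqrt (F z) * of_real (sqrt (r z))))"

text \<open>
  On the image of the chart \<open>E\<close> is \<open>(G/F - 1)/r\<close>, so \<open>1 - Re E = 1/r\<close>, and \<open>D\<close> is the square of
  \<open>(z\<^sub>j/p\<^sub>j) / (F r)\<^bsup>1/2\<^esup>\<close>, the one coordinate that \<open>v\<close> does not record.  As \<open>\<kappa> j = 0\<close>, the \<open>j\<close>-th term in the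
  sum defining \<open>D\<close> is \<open>0\<close> by the convention \<open>x/0 = 0\<close>.
\<close>

definition E :: "complex ^ 'n \<Rightarrow> complex" where "E v = \<i> * (\<Sum>k\<in>UNIV. (v $ k)\<^sup>2)"
definition D :: "complex ^ 'n \<Rightarrow> complex" where
  "D v = of_real (1 - Re (E v)) - (\<Sum>k\<in>UNIV. c k / c j * (v $ k / \<kappa> k)\<^sup>2)"
text \<open>Positive scaling of \<open>z\<close> changes neither \<open>morse z\<close> nor the
  slope of \<open>F z\<close>. So \<open>\<omega>\<close> gives the ratios
  \<open>z $ k / p $ j\<close> up to a positive factor, with the square root putting
  \<open>F\<close> on the ray of 1 + it, and \<open>chart_inv\<close> then fixes the norm.\<close>

definition \<omega> :: "complex ^ 'n \<Rightarrow> real \<Rightarrow> complex ^ 'n" where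
  "\<omega> v t = (\<chi> k. csqrt (1 + \<i> * of_real t) * (if k = j then csqrt (D v) else v $ k / \<kappa> k))"
definition chart_inv :: "complex ^ 'n \<Rightarrow> real \<Rightarrow> complex ^ 'n" where
  "chart_inv v t = (\<chi> k. p $ j / of_real (norm (\<omega> v t)) * \<omega> v t $ k)"
text \<open>The image of \<open>chart_dom\<close> under \<open>morse\<close>: the conditions reflect
  \<open>\<kappa> j = 0\<close>, the positivity of \<open>r\<close>, and \<open>D v\<close> being
  the square of a number with positive real part.\<close>

definition chart_range :: "(complex ^ 'n) set" where
  "chart_range = {v. v $ j = 0 \<and> Re (E v) < 1 \<and> D v \<notin> \<real>\<^sub>\<le>\<^sub>0}"

lemma pj: "p $ j \<noteq> 0" "k \<noteq> j \<Longrightarrow> p $ k = 0"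
  using p_axis by (auto simp: axis_point_def)

lemma norm_p: "norm p = cmod (p $ j)"
proof -
  have "norm p = L2_set (\<lambda>k. if k = j then cmod (p $ j) else 0) UNIV"
    unfolding norm_vec_def by (intro L2_set_cong) (auto simp: pj)
  then show ?thesis by (simp add: L2_set_def if_distrib[where f="\<lambda>x. x\<^sup>2"] cong: if_cong)
qed

lemma f_eq: "f z = F z * f p" and g_eq: "g z = G z * g p"
  unfolding axis_point_values(1,2)[OF p_axis]
  unfolding f_def g_def F_def G_def
  unfolding m_eq using c_nonzero d_nonzero pj by (simp_all add: sum_distrib_right power_divide)

lemma fg_p: "f p \<noteq> 0" "g p \<noteq> 0" using axis_point_nonzero[OF p_axis] by auto

lemma F_p: "F p = 1" and G_p: "G p = 1"
  using f_eq[of p] g_eq[of p] fg_p by simp_all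

lemma \<kappa>_j: "\<kappa> j = 0" by (simp add: \<kappa>_def ratio_def c_nonzero d_nonzero)

lemma \<kappa>_square: "(\<kappa> k)\<^sup>2 = - \<i> * ratio k" by (simp add: \<kappa>_def)

lemma \<kappa>_nonzero: "k \<noteq> j \<Longrightarrow> \<kappa> k \<noteq> 0"
  using det_nonzero[of j k] c_nonzero d_nonzero by (auto simp: \<kappa>_def ratio_def field_simps)

lemma smooth_F: "smooth_on_open UNIV F" and smooth_G: "smooth_on_open UNIV G"
  unfolding F_def[abs_def] G_def[abs_def] by (intro smooth_intros open_UNIV pj)+

lemma Re_F_notin: "Re (F z) > 0 \<Longrightarrow> F z \<notin> \<real>\<^sub>\<le>\<^sub>0" "Re (F z) > 0 \<Longrightarrow> F z \<noteq> 0"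
  by (auto simp: complex_nonpos_Reals_iff)

lemma open_chart_dom: "open chart_dom"
proof -
  have o: "open {z. Re (F z) > 0}"
    using smooth_on_open_continuous_on[OF smooth_F] by (intro open_Collect_less continuous_intros)
  have "smooth_on_open {z. Re (F z) > 0} r"
    unfolding r_def[abs_def]
    by (intro smooth_intros smooth_on_open_subset[OF smooth_F o] smooth_on_open_subset[OF smooth_G o]) auto
  moreover have "smooth_on_open {z. Re (F z) > 0} (\<lambda>z. Re (z $ j / p $ j / csqrt (F z)))"
    by (intro smooth_intros smooth_on_open_subset[OF smooth_F o] o pj) (use Re_F_notin in auto)
  ultimately show ?thesis unfolding chart_dom_def
    by (intro open_Collect_pos_conj o continuous_on_min smooth_on_open_continuous_on)
qed

lemma smooth_morse: "smooth_on_open chart_dom morse"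
  unfolding morse_def[abs_def] r_def
  by (intro smooth_intros open_chart_dom smooth_on_open_subset[OF smooth_F open_chart_dom]
      smooth_on_open_subset[OF smooth_G open_chart_dom])
     (use pj Re_F_notin in \<open>auto simp: chart_dom_def r_def\<close>)

lemma p_chart_dom: "p \<in> chart_dom"
  using pj by (simp add: chart_dom_def r_def F_p G_p)

lemma morse_p: "morse p = 0"
  by (simp add: morse_def vec_eq_iff) (metis \<kappa>_j pj(2))

lemma morse_j: "morse z $ j = 0"
  by (simp add: morse_def \<kappa>_j)

lemma sum_ratio: "(\<Sum>k\<in>UNIV. ratio k * (z $ k / p $ j)\<^sup>2) = G z - F z"
  by (simp add: F_def G_def ratio_def left_diff_distrib sum_subtractf)

text \<open>The factor \<i> in \<open>E\<close> cancels the -\<i> in the square of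
  \<open>\<kappa> k\<close>, leaving the sum of \<open>sum_ratio\<close>, that is
  \<open>G z - F z\<close>, over \<open>F z * r z\<close>.\<close>

lemma E_morse:
  assumes "z \<in> chart_dom" shows "E (morse z) = (G z / F z - 1) / of_real (r z)"
proof -
  have z: "F z \<noteq> 0" "r z > 0" using assms Re_F_notin by (auto simp: chart_dom_def)
  have R: "(of_real (sqrt (r z)) :: complex)\<^sup>2 = of_real (r z)"
    using z by (simp flip: of_real_power)
  have "E (morse z) = (\<Sum>k\<in>UNIV. ratio k * (z $ k / p $ j)\<^sup>2) / (F z * of_real (r z))"
    by (simp add: E_def morse_def power_mult_distrib power_divide R \<kappa>_square sum_divide_distrib sum_distrib_left field_simps)
  then show ?thesis unfolding sum_ratio using z by (simp add: field_simps)
qed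

lemma Re_E_morse: "z \<in> chart_dom \<Longrightarrow> Re (E (morse z)) = 1 - 1 / r z"
  by (simp add: E_morse Re_divide_of_real) (auto simp: r_def chart_dom_def field_simps)

text \<open>The terms of \<open>F\<close> with index other than \<open>j\<close> can be read off
  from \<open>morse z\<close>. Removing them from 1/r leaves the \<open>j\<close>-th square over
  \<open>F z * r z\<close>.\<close>

lemma D_morse:
  assumes "z \<in> chart_dom"
  shows "D (morse z) = (z $ j / p $ j / (csqrt (F z) * of_real (sqrt (r z))))\<^sup>2"
proof -
  have z: "F z \<noteq> 0" "r z > 0" using assms Re_F_notin by (auto simp: chart_dom_def)
  have R: "(of_real (sqrt (r z)) :: complex)\<^sup>2 = of_real (r z)"
    using z by (simp flip: of_real_power)
  have "c k / c j * (morse z $ k / \<kappa> k)\<^sup>2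
      = (if k = j then 0 else c k / c j * (z $ k / p $ j)\<^sup>2) / (F z * of_real (r z))" for k
    using \<kappa>_nonzero[of k] by (auto simp: morse_def \<kappa>_j power_divide power_mult_distrib R)
  then have "(\<Sum>k\<in>UNIV. c k / c j * (morse z $ k / \<kappa> k)\<^sup>2)
      = (\<Sum>k\<in>UNIV. if k = j then 0 else c k / c j * (z $ k / p $ j)\<^sup>2) / (F z * of_real (r z))"
    by (simp add: sum_divide_distrib)
  also have "(\<Sum>k\<in>UNIV. if k = j then 0 else c k / c j * (z $ k / p $ j)\<^sup>2) = F z - (z $ j / p $ j)\<^sup>2"
    unfolding F_def by (subst (1 2) sum.remove[of _ j]) (auto simp: c_nonzero)
  finally have S: "(\<Sum>k\<in>UNIV. c k / c j * (morse z $ k / \<kappa> k)\<^sup>2) = (F z - (z $ j / p $ j)\<^sup>2) / (F z * of_real (r z))" .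
  show ?thesis
    unfolding D_def S Re_E_morse[OF assms]
    unfolding power_divide power_mult_distrib R power2_csqrt
    using z by (simp add: field_simps)
qed

lemma Re_morse_j:
  assumes "z \<in> chart_dom"
  shows "Re (z $ j / p $ j / (csqrt (F z) * of_real (sqrt (r z)))) > 0"
proof -
  have "z $ j / p $ j / (csqrt (F z) * of_real (sqrt (r z))) = z $ j / p $ j / csqrt (F z) / of_real (sqrt (r z))"
    by simp
  then show ?thesis using assms unfolding chart_dom_def by (simp only: Re_divide_of_real) simp
qed

lemma morse_in_range: "z \<in> chart_dom \<Longrightarrow> morse z \<in> chart_range"
  unfolding chart_range_def using morse_j Re_morse_j
  by (auto simp: Re_E_morse D_morse square_notin_nonpos_Reals chart_dom_def)

text \<open>Normalising to the circles multiplies \<open>F\<close> and \<open>G/F\<close> by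
  positive reals, which slopes ignore. The division by \<open>r\<close> in \<open>E_morse\<close>
  turns the imaginary part of \<open>G/F\<close> into its slope, so the quadratic form is exact,
  without remainder.\<close>

lemma torus_chart_milnor_product:
  assumes "z \<in> chart_dom"
  shows "torus_chart (milnor_product f g p) (milnor_product f g z)
      = (slope (F z), \<Sum>k\<in>UNIV. Re ((morse z $ k)\<^sup>2))"
    and "milnor_product f g z \<in> torus_chart_dom (milnor_product f g p)"
proof -
  have z: "F z \<noteq> 0" "r z > 0" "Re (F z) > 0" using assms Re_F_notin by (auto simp: chart_dom_def)
  then have Gz: "G z \<noteq> 0" by (auto simp: r_def)
  have 1: "fst (milnor_product f g z) / fst (milnor_product f g p) = F z * of_real (1 / cmod (F z))"
    and 2: "snd (milnor_product f g z) / snd (milnor_product f g p)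
       / (fst (milnor_product f g z) / fst (milnor_product f g p)) = G z / F z * of_real (cmod (F z) / cmod (G z))"
    using fg_p z by (auto simp: milnor_product_def f_eq[of z] g_eq[of z] norm_mult field_simps)
  have "(\<Sum>k\<in>UNIV. Re ((morse z $ k)\<^sup>2)) = Im (E (morse z))" by (simp add: E_def)
  also have "\<dots> = slope (G z / F z)"
    by (simp add: E_morse[OF assms] slope_def r_def Im_divide_of_real)
  finally have 3: "(\<Sum>k\<in>UNIV. Re ((morse z $ k)\<^sup>2)) = slope (G z / F z)" .
  show "torus_chart (milnor_product f g p) (milnor_product f g z)
      = (slope (F z), \<Sum>k\<in>UNIV. Re ((morse z $ k)\<^sup>2))"
    unfolding torus_chart_def 2 3
    unfolding 1 using z Gz by (subst (1 2) slope_mult_of_real) auto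
  have "Re (G z / F z * of_real (cmod (F z) / cmod (G z))) = r z * (cmod (F z) / cmod (G z))"
    unfolding r_def by (simp only: Re_complex_of_real times_complex.sel Im_complex_of_real mult_zero_right diff_zero)
  then show "milnor_product f g z \<in> torus_chart_dom (milnor_product f g p)"
    unfolding torus_chart_dom_def mem_Collect_eq 2
    unfolding 1 using z Gz by simp
qed

text \<open>Since 1 + \<i> slope(F) = F / Re F, the root differs from \<open>csqrt (F z)\<close> by
  a positive factor.\<close>

lemma csqrt_slope:
  assumes "z \<in> chart_dom"
  shows "csqrt (1 + \<i> * of_real (slope (F z))) = csqrt (F z) / of_real (sqrt (Re (F z)))"
proof (rule csqrt_eqI)
  have z: "Re (F z) > 0" using assms by (auto simp: chart_dom_def)
  have R: "(of_real (sqrt (Re (F z))) :: complex)\<^sup>2 = of_real (Re (F z))"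
    using z by (simp flip: of_real_power)
  show "(csqrt (F z) / of_real (sqrt (Re (F z))))\<^sup>2 = 1 + \<i> * of_real (slope (F z))"
    unfolding power_divide R using z by (simp add: slope_def complex_eq_iff)
  show "Re (csqrt (F z) / of_real (sqrt (Re (F z)))) > 0"
    using Re_csqrt_pos[OF Re_F_notin(1)[OF z]] z by (simp only: Re_divide_of_real) simp
qed

text \<open>Here \<open>\<omega>\<close> comes out as \<open>z\<close> divided by
  \<open>p $ j\<close> and by a positive real; as \<open>z\<close> and \<open>p\<close> have equal
  norm, the rescaling in \<open>chart_inv\<close> undoes both.\<close>

lemma chart_inv_morse:
  assumes "z \<in> chart_dom" "norm z = norm p"
  shows "chart_inv (morse z) (slope (F z)) = z"
proof -
  have z: "F z \<noteq> 0" "r z > 0" "Re (F z) > 0" using assms Re_F_notin by (auto simp: chart_dom_def)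
  have "csqrt (D (morse z)) = z $ j / p $ j / (csqrt (F z) * of_real (sqrt (r z)))"
    by (rule csqrt_eqI[OF D_morse[OF assms(1), symmetric] Re_morse_j[OF assms(1)]])
  then have \<omega>: "\<omega> (morse z) (slope (F z)) = (\<chi> k. inverse (p $ j * of_real (sqrt (Re (F z)) * sqrt (r z))) * z $ k)"
    unfolding \<omega>_def csqrt_slope[OF assms(1)]
    using z \<kappa>_nonzero pj by (auto simp: vec_eq_iff morse_def field_simps)
  have n: "norm (\<omega> (morse z) (slope (F z))) = 1 / (sqrt (Re (F z)) * sqrt (r z))"
    unfolding \<omega> norm_vec_cmult assms(2) norm_p using z pj by (simp add: norm_mult norm_divide field_simps)
  show ?thesis unfolding chart_inv_def n unfolding \<omega> using z pj by (simp add: vec_eq_iff field_simps)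
qed

section \<open>The explicit inverse of the Morse chart\<close>

context
  fixes v :: "complex ^ 'n" and t :: real assumes v: "v \<in> chart_range"
begin

private definition "z = chart_inv v t"
private definition "q = csqrt (1 + \<i> * of_real t)"
private definition "N = norm (\<omega> v t)"
private definition "\<rho> = 1 - Re (E v)"

private lemma q: "q\<^sup>2 = 1 + \<i> * of_real t" "Re q > 0" "q \<noteq> 0"
proof -
  show "Re q > 0" unfolding q_def by (rule Re_csqrt_pos) (auto simp: complex_nonpos_Reals_iff)
  then show "q \<noteq> 0" by auto
qed (simp add: q_def)

private lemma \<rho>: "\<rho> > 0" using v by (simp add: chart_range_def \<rho>_def)

private lemma Re_sqrt_D: "Re (csqrt (D v)) > 0"
  by (rule Re_csqrt_pos) (use v in \<open>simp add: chart_range_def\<close>)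

private lemma \<omega>_j: "\<omega> v t $ j = q * csqrt (D v)" and \<omega>_k: "k \<noteq> j \<Longrightarrow> \<omega> v t $ k = q * (v $ k / \<kappa> k)"
  by (simp_all add: \<omega>_def q_def)

private lemma N: "N > 0"
proof -
  have "\<omega> v t $ j \<noteq> 0" unfolding \<omega>_j using q Re_sqrt_D by auto
  then show ?thesis unfolding N_def by force
qed

lemma norm_omega_nonzero: "\<omega> v t \<noteq> 0" using N by (auto simp: N_def)

private lemma z_k: "z $ k / p $ j = \<omega> v t $ k / of_real N"
  using pj by (simp add: z_def chart_inv_def N_def)

text \<open>\<open>D\<close> is made so that the squared \<open>j\<close>-th entry and the weighted
  squares of the others add up to the positive real \<open>\<rho>\<close>; hence \<open>F z\<close>
  has the argument of the square of \<open>q\<close>.\<close>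

private lemma F_z: "F z = (q * of_real (sqrt \<rho>) / of_real N)\<^sup>2"
proof -
  have "F z = (\<Sum>k\<in>UNIV. c k / c j * (\<omega> v t $ k)\<^sup>2) / (of_real N)\<^sup>2"
    by (simp add: F_def z_k power_divide sum_divide_distrib)
  also have "(\<Sum>k\<in>UNIV. c k / c j * (\<omega> v t $ k)\<^sup>2) = q\<^sup>2 * (D v + (\<Sum>k\<in>UNIV. c k / c j * (v $ k / \<kappa> k)\<^sup>2))"
    by (subst (1 2) sum.remove[of _ j])
       (auto simp: \<omega>_j \<omega>_k \<kappa>_j c_nonzero power_mult_distrib power_divide sum_distrib_left algebra_simps intro!: sum.cong)
  also have "D v + (\<Sum>k\<in>UNIV. c k / c j * (v $ k / \<kappa> k)\<^sup>2) = of_real \<rho>" by (simp add: D_def \<rho>_def)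
  also have "of_real \<rho> = (of_real (sqrt \<rho>) :: complex)\<^sup>2" using \<rho> by (simp flip: of_real_power)
  finally show ?thesis by (simp add: power_divide power_mult_distrib)
qed

private lemma sqrt_F_z: "csqrt (F z) = q * of_real (sqrt \<rho>) / of_real N"
proof (rule csqrt_eqI[OF F_z[symmetric]])
  have "q * of_real (sqrt \<rho>) / of_real N = of_real (sqrt \<rho> / N) * q" by simp
  then show "0 < Re (q * of_real (sqrt \<rho>) / of_real N)"
    using q \<rho> N by (simp only: Re_complex_of_real times_complex.sel Im_complex_of_real) simp
qed

private lemma F_z': "F z = of_real (\<rho> / N\<^sup>2) * (1 + \<i> * of_real t)"
proof -
  have "(of_real (sqrt \<rho>) :: complex)\<^sup>2 = of_real \<rho>" using \<rho> by (simp flip: of_real_power)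
  then show ?thesis unfolding F_z by (simp add: power_divide power_mult_distrib q)
qed

private lemma Re_F_z: "Re (F z) > 0" and slope_F_z: "slope (F z) = t"
  unfolding F_z' slope_def using \<rho> N by simp_all

text \<open>Away from \<open>j\<close>, \<open>ratio k\<close> is \<i> times the square of
  \<open>\<kappa> k\<close>, which cancels the division by \<open>\<kappa> k\<close> in
  \<open>\<omega>\<close>; at \<open>j\<close> both \<open>ratio\<close> and \<open>v\<close>
  vanish. So \<open>G z - F z\<close> is a multiple of \<open>E v\<close>.\<close>

private lemma G_z: "G z = F z * (1 + E v / of_real \<rho>)"
proof -
  have "G z = F z + (\<Sum>k\<in>UNIV. ratio k * (\<omega> v t $ k / of_real N)\<^sup>2)"
    using sum_ratio[of z] by (simp add: z_k algebra_simps)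
  also have "(\<Sum>k\<in>UNIV. ratio k * (\<omega> v t $ k / of_real N)\<^sup>2) = (\<Sum>k\<in>UNIV. q\<^sup>2 / (of_real N)\<^sup>2 * (\<i> * (v $ k)\<^sup>2))"
  proof (rule sum.cong[OF refl])
    fix k
    show "ratio k * (\<omega> v t $ k / of_real N)\<^sup>2 = q\<^sup>2 / (of_real N)\<^sup>2 * (\<i> * (v $ k)\<^sup>2)"
    proof (cases "k = j")
      case True
      then show ?thesis using v c_nonzero d_nonzero by (simp add: ratio_def chart_range_def)
    next
      case False
      have "ratio k = \<i> * (\<kappa> k)\<^sup>2" by (simp add: \<kappa>_square)
      then show ?thesis using \<kappa>_nonzero[OF False] by (simp add: \<omega>_k[OF False] power_divide power_mult_distrib)
    qed
  qed
  also have "\<dots> = q\<^sup>2 / (of_real N)\<^sup>2 * E v" by (simp add: E_def sum_distrib_left)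
  also have "\<dots> = F z * E v / of_real \<rho>" unfolding F_z' q using \<rho> by simp
  finally show ?thesis by (simp add: algebra_simps)
qed

text \<open>With \<open>Re (E v) = 1 - \<rho>\<close>, the real part of 1 + E/\<rho> collapses to
  1/\<rho>.\<close>

private lemma r_z: "r z = 1 / \<rho>"
proof -
  have "F z \<noteq> 0" using Re_F_z by auto
  then have "G z / F z = 1 + E v / of_real \<rho>" by (simp add: G_z)
  then have "r z = 1 + Re (E v) / \<rho>" by (simp add: r_def Re_divide_of_real)
  then show ?thesis using \<rho> by (simp add: \<rho>_def field_simps)
qed

lemma chart_inv_in_dom: "chart_inv v t \<in> chart_dom"
proof -
  have "z $ j / p $ j / csqrt (F z) = csqrt (D v) / of_real (sqrt \<rho>)"
    unfolding z_k sqrt_F_z \<omega>_j using q N \<rho> by (simp add: field_simps)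
  then have "Re (z $ j / p $ j / csqrt (F z)) = Re (csqrt (D v)) / sqrt \<rho>"
    by (simp only: Re_divide_of_real)
  then show ?thesis
    using Re_F_z r_z Re_sqrt_D \<rho> unfolding chart_dom_def z_def by simp
qed

lemma norm_chart_inv: "norm (chart_inv v t) = norm p"
  unfolding chart_inv_def norm_vec_cmult norm_p using N by (simp add: N_def norm_divide)

lemma morse_chart_inv: "morse (chart_inv v t) = v"
proof -
  have "morse z $ k = v $ k" for k
  proof (cases "k = j")
    case True
    then show ?thesis using morse_j v by (simp add: chart_range_def)
  next
    case False
    have "(of_real (sqrt \<rho>) :: complex) * of_real (sqrt (1 / \<rho>)) = 1"
      using \<rho> by (simp add: real_sqrt_divide flip: of_real_mult)
    moreover have "morse z $ k = \<kappa> k * (\<omega> v t $ k / of_real N) / (q / of_real N * (of_real (sqrt \<rho>) * of_real (sqrt (1 / \<rho>))))"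
      by (simp add: morse_def z_k sqrt_F_z r_z mult.assoc)
    ultimately show ?thesis
      using q N \<kappa>_nonzero[OF False] by (simp add: \<omega>_k[OF False])
  qed
  then show ?thesis by (simp add: vec_eq_iff z_def)
qed

lemma slope_F_chart_inv: "slope (F (chart_inv v t)) = t"
  using slope_F_z by (simp add: z_def)

end

text \<open>The entries of \<open>morse z\<close> off the axis \<open>j\<close> supply 2n - 2 real
  coordinates and the slope of \<open>F\<close> the last one. Together with
  \<open>torus_chart\<close> they give the fold normal form with \<lambda> = n - 1.\<close>

lemma fold_point_axis:
  assumes "norm p = \<epsilon>" "\<epsilon> > 0" "CARD('n) \<ge> 2"
  shows "fold_point (link_complement \<epsilon>) torus (milnor_product f g) p"
proof -
  let ?M = "link_complement \<epsilon>" and ?\<Phi> = "milnor_product f g"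
  define n where "n = CARD('n)"
  have n2: "n \<ge> 2" using assms(3) by (simp add: n_def)
  have "card (UNIV - {j}) = n - 1" by (simp add: n_def card_Diff_singleton)
  \<comment> \<open>Coordinates are numbered from 1, so the axes other than \<open>j\<close> are
    too.\<close>
  then obtain h where h: "bij_betw h {1..n - 1} (UNIV - {j})"
    using ex_bij_betw_nat_finite_1[of "UNIV - {j}"] by auto
  define h' where "h' = inv_into {1..n - 1} h"
  have hh': "h (h' k) = k" "h' k \<in> {1..n - 1}" if "k \<noteq> j" for k
    using that bij_betw_inv_into_right[OF h, of k] bij_betw_apply[OF bij_betw_inv_into[OF h], of k]
    by (simp_all add: h'_def)
  have h'h: "h' (h i) = i" "h i \<noteq> j" if "i \<in> {1..n - 1}" for i
    using that h by (auto simp: h'_def bij_betw_def inv_into_f_f)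
  \<comment> \<open>The imaginary parts come first because their squares enter Re(v^2) negatively;
    the real parts follow, shifted by n - 1.\<close>
  define pack :: "complex ^ 'n \<Rightarrow> real \<Rightarrow> real ^ 'n cidx" where
    "pack v t = (\<chi> i. if Rep_cidx i \<le> n - 1 then Im (v $ h (Rep_cidx i))
       else if Rep_cidx i \<le> 2 * n - 2 then Re (v $ h (Rep_cidx i - (n - 1))) else t)" for v t
  define unpack :: "real ^ 'n cidx \<Rightarrow> complex ^ 'n" where
    "unpack X = (\<chi> k. if k = j then 0 else
       of_real (coord X (n - 1 + h' k)) + \<i> * of_real (coord X (h' k)))" for X
  define last :: "real ^ 'n cidx \<Rightarrow> real" where "last X = coord X (2 * n - 1)" for X
  have rep: "Rep_cidx i \<in> {1..2 * n - 1}" for i :: "'n cidx" using Rep_cidx[of i] by (simp add: n_def)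
  have coord_pack: "coord (pack v t) i = (if i \<le> n - 1 then Im (v $ h i)
       else if i \<le> 2 * n - 2 then Re (v $ h (i - (n - 1))) else t)" if "i \<in> {1..2 * n - 1}" for v t i
    using that Abs_cidx_inverse[of i, where 'n='n] by (simp add: coord_def pack_def n_def)
  have last_pack: "last (pack v t) = t" for v t
    using n2 unfolding last_def by (subst coord_pack) auto
  have unpack_pack: "unpack (pack v t) = v" if "v $ j = 0" for v t
  proof -
    have "of_real (coord (pack v t) (n - 1 + h' k)) + \<i> * of_real (coord (pack v t) (h' k)) = v $ k" if "k \<noteq> j" for k
    proof -
      have "coord (pack v t) (h' k) = Im (v $ k)"
        using hh'[OF that] by (subst coord_pack) auto
      moreover have "coord (pack v t) (n - 1 + h' k) = Re (v $ k)"
        using hh'[OF that] by (subst coord_pack) auto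
      ultimately show ?thesis by (simp add: complex_eq_iff)
    qed
    then show ?thesis using that by (auto simp: unpack_def vec_eq_iff)
  qed
  have pack_unpack: "pack (unpack X) (last X) = X" for X
  proof -
    have "pack (unpack X) (last X) $ i = X $ i" for i
    proof -
      have X: "coord X (Rep_cidx i) = X $ i" by (simp add: coord_def Rep_cidx_inverse)
      consider "Rep_cidx i \<in> {1..n - 1}" | "Rep_cidx i - (n - 1) \<in> {1..n - 1}" "\<not> Rep_cidx i \<le> n - 1" "Rep_cidx i \<le> 2 * n - 2"
        | "Rep_cidx i = 2 * n - 1" using rep[of i] by force
      then show ?thesis
      proof cases
        case 1
        then show ?thesis using h'h[OF 1] X by (simp add: pack_def unpack_def)
      next
        case 2
        then show ?thesis using h'h[OF 2(1)] X by (simp add: pack_def unpack_def)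
      next
        case 3
        then show ?thesis using n2 X by (auto simp: pack_def last_def)
      qed
    qed
    then show ?thesis by (simp add: vec_eq_iff)
  qed
  have unpack_j: "unpack X $ j = 0" for X by (simp add: unpack_def)
  have smooth_unpack: "smooth_on_open UNIV unpack"
    unfolding unpack_def coord_def
  proof (rule smooth_on_open_vec_lambda[OF open_UNIV])
    fix k
    show "smooth_on_open UNIV (\<lambda>X :: real ^ 'n cidx. if k = j then 0 else
        of_real (X $ Abs_cidx (n - 1 + h' k)) + \<i> * of_real (X $ Abs_cidx (h' k)))"
      by (cases "k = j") (simp_all add: smooth_intros)
  qed
  have smooth_last: "smooth_on_open UNIV last"
    unfolding last_def coord_def by (intro smooth_intros open_UNIV)
  have smooth_E: "smooth_on_open UNIV E"
    unfolding E_def[abs_def] by (intro smooth_intros open_UNIV)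
  \<comment> \<open>Division by \<open>\<kappa> k\<close>, which is 0 for \<open>k = j\<close>, is
    read as multiplication by a constant, so that smoothness has no side condition.\<close>
  have smooth_D: "smooth_on_open UNIV D"
    unfolding D_def[abs_def] divide_inverse by (intro smooth_intros open_UNIV smooth_E)
  \<comment> \<open>\<open>chart_range\<close> lies in the hyperplane \<open>v $ j = 0\<close> and
    is not open. Its preimage is, because \<open>unpack\<close> always produces 0 at
    \<open>j\<close>.\<close>
  define W where "W = {X. unpack X \<in> chart_range}"
  have W: "open W"
  proof -
    note cE = smooth_on_open_continuous_on[OF smooth_on_open_linears(1)[OF smooth_on_open_compose[OF smooth_E smooth_unpack subset_UNIV]]]
    note cD = smooth_on_open_continuous_on[OF smooth_on_open_compose[OF smooth_D smooth_unpack subset_UNIV]]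
    have "open {X. Re (E (unpack X)) < 1}"
      by (rule open_Collect_less[OF cE continuous_on_const])
    moreover have "open ((\<lambda>X. D (unpack X)) -` (- \<real>\<^sub>\<le>\<^sub>0))"
      by (rule open_vimage[OF open_Compl[OF closed_nonpos_Reals_complex] cD])
    moreover have "W = {X. Re (E (unpack X)) < 1} \<inter> (\<lambda>X. D (unpack X)) -` (- \<real>\<^sub>\<le>\<^sub>0)"
      by (auto simp: W_def chart_range_def unpack_j)
    ultimately show ?thesis by auto
  qed
  define \<psi> where "\<psi> X = chart_inv (unpack X) (last X)" for X
  have smooth_omega: "smooth_on_open W (\<lambda>X. \<omega> (unpack X) (last X))"
    unfolding \<omega>_def
  proof (rule smooth_on_open_vec_lambda[OF W])
    fix k
    have 1: "smooth_on_open W (\<lambda>X. csqrt (1 + \<i> * of_real (last X)))"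
      by (intro smooth_intros W smooth_on_open_subset[OF smooth_last W]) (auto simp: complex_nonpos_Reals_iff)
    have 2: "smooth_on_open W (\<lambda>X. csqrt (D (unpack X)))"
      by (intro smooth_intros smooth_on_open_subset[OF smooth_on_open_compose[OF smooth_D smooth_unpack] W])
         (auto simp: W_def chart_range_def)
    have 3: "smooth_on_open W (\<lambda>X. unpack X $ k * inverse (\<kappa> k))"
      by (intro smooth_intros W smooth_on_open_subset[OF smooth_unpack W]) auto
    show "smooth_on_open W (\<lambda>X. csqrt (1 + \<i> * of_real (last X)) *
        (if k = j then csqrt (D (unpack X)) else unpack X $ k / \<kappa> k))"
      using smooth_on_open_bilinears(1)[OF 1 2] smooth_on_open_bilinears(1)[OF 1 3]
      by (cases "k = j") (simp_all add: divide_inverse)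
  qed
  have smooth_\<psi>: "smooth_on_open W \<psi>"
    unfolding \<psi>_def[abs_def] chart_inv_def
    by (intro smooth_intros W smooth_omega) (use norm_omega_nonzero in \<open>auto simp: W_def\<close>)
  define x where "x z = pack (morse z) (slope (F z))" for z
  have smooth_x: "smooth_on_open chart_dom x"
    unfolding x_def[abs_def] pack_def
  proof (rule smooth_on_open_vec_lambda[OF open_chart_dom])
    fix i :: "'n cidx"
    have 1: "smooth_on_open chart_dom (\<lambda>z. slope (F z))"
      by (intro smooth_intros smooth_on_open_subset[OF smooth_F open_chart_dom]) (auto simp: chart_dom_def)
    have 2: "smooth_on_open chart_dom (\<lambda>z. Re (morse z $ k))" "smooth_on_open chart_dom (\<lambda>z. Im (morse z $ k))" for k
      by (intro smooth_intros smooth_morse)+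
    show "smooth_on_open chart_dom (\<lambda>z. if Rep_cidx i \<le> n - 1 then Im (morse z $ h (Rep_cidx i))
       else if Rep_cidx i \<le> 2 * n - 2 then Re (morse z $ h (Rep_cidx i - (n - 1))) else slope (F z))"
      using 1 2 by (cases "Rep_cidx i \<le> n - 1"; cases "Rep_cidx i \<le> 2 * n - 2") simp_all
  qed
  have dom_link: "sphere 0 \<epsilon> \<inter> chart_dom \<subseteq> ?M"
  proof
    fix z assume z: "z \<in> sphere 0 \<epsilon> \<inter> chart_dom"
    then have "F z \<noteq> 0" "r z \<noteq> 0" using Re_F_notin by (auto simp: chart_dom_def)
    then have "G z \<noteq> 0" by (auto simp: r_def)
    then show "z \<in> ?M" using z \<open>F z \<noteq> 0\<close> fg_p by (simp add: link_complement_eq f_eq[of z] g_eq[of z])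
  qed
  have "local_coords ?M p (?M \<inter> chart_dom) x"
  proof (rule local_coordsI[where T=chart_dom and W=W and \<psi>=\<psi>])
    show "openin (top_of_set ?M) (?M \<inter> chart_dom)" using open_chart_dom by (simp add: openin_open_Int)
    show "p \<in> ?M \<inter> chart_dom" using p_chart_dom fg_p assms by (simp add: link_complement_eq)
    show "x p = 0" by (simp add: x_def morse_p F_p slope_def pack_def vec_eq_iff)
    show "smooth_on_open chart_dom x" by (rule smooth_x)
    show "smooth_on_open W \<psi>" by (rule smooth_\<psi>)
    show "x z \<in> W" if "z \<in> ?M \<inter> chart_dom" for z
      using that morse_in_range by (simp add: x_def W_def unpack_pack morse_j)
    show "\<psi> X \<in> ?M \<inter> chart_dom" if "X \<in> W" for X
    proof -
      have "\<psi> X \<in> sphere 0 \<epsilon> \<inter> chart_dom"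
        using that assms(1) chart_inv_in_dom norm_chart_inv by (simp add: W_def \<psi>_def)
      then show ?thesis using dom_link by blast
    qed
    show "\<psi> (x z) = z" if "z \<in> ?M \<inter> chart_dom" for z
      using that assms(1) by (simp add: \<psi>_def x_def unpack_pack morse_j last_pack chart_inv_morse link_complement_eq)
    show "x (\<psi> X) = X" if "X \<in> W" for X
      using that by (simp add: \<psi>_def x_def W_def morse_chart_inv slope_F_chart_inv pack_unpack)
  qed auto
  moreover have w: "?\<Phi> p \<in> torus"
    using fg_p by (simp add: torus_def milnor_product_def norm_divide)
  moreover have "?\<Phi> ` (?M \<inter> chart_dom) \<subseteq> torus \<inter> torus_chart_dom (?\<Phi> p)"
    using torus_chart_milnor_product(2) by (auto simp: torus_def milnor_product_def norm_divide link_complement_eq)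
  moreover have "fst (torus_chart (?\<Phi> p) (?\<Phi> z)) = coord (x z) (2 * CARD('n) - 1) \<and>
      snd (torus_chart (?\<Phi> p) (?\<Phi> z)) = - (\<Sum>i = 1..n - 1. (coord (x z) i)\<^sup>2)
        + (\<Sum>i = n - 1 + 1..2 * CARD('n) - 2. (coord (x z) i)\<^sup>2)" if "z \<in> ?M \<inter> chart_dom" for z
  proof -
    have z: "z \<in> chart_dom" using that by simp
    have "(\<Sum>i = 1..n - 1. (coord (x z) i)\<^sup>2) = (\<Sum>i = 1..n - 1. (Im (morse z $ h i))\<^sup>2)"
      unfolding x_def by (intro sum.cong refl) (subst coord_pack, auto)
    also have "\<dots> = (\<Sum>k\<in>UNIV - {j}. (Im (morse z $ k))\<^sup>2)"
      by (rule sum.reindex_bij_betw[OF h])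
    finally have 1: "(\<Sum>i = 1..n - 1. (coord (x z) i)\<^sup>2) = (\<Sum>k\<in>UNIV - {j}. (Im (morse z $ k))\<^sup>2)" .
    \<comment> \<open>The positive squares carry the indices n to 2n - 2; a shift by n - 1 makes
      them start at 1, as \<open>h\<close> requires.\<close>
    have "{n - 1 + 1..2 * n - 2} = {1 + (n - 1)..n - 1 + (n - 1)}" by auto
    then have "(\<Sum>i = n - 1 + 1..2 * n - 2. (coord (x z) i)\<^sup>2) = (\<Sum>i = 1..n - 1. (coord (x z) (i + (n - 1)))\<^sup>2)"
      by (simp only: sum.shift_bounds_cl_nat_ivl)
    also have "\<dots> = (\<Sum>i = 1..n - 1. (Re (morse z $ h i))\<^sup>2)"
      unfolding x_def by (intro sum.cong refl) (subst coord_pack, auto)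
    also have "\<dots> = (\<Sum>k\<in>UNIV - {j}. (Re (morse z $ k))\<^sup>2)"
      by (rule sum.reindex_bij_betw[OF h])
    finally have 2: "(\<Sum>i = n - 1 + 1..2 * n - 2. (coord (x z) i)\<^sup>2) = (\<Sum>k\<in>UNIV - {j}. (Re (morse z $ k))\<^sup>2)" .
    have "(\<Sum>k\<in>UNIV. Re ((morse z $ k)\<^sup>2)) = (\<Sum>k\<in>UNIV - {j}. Re ((morse z $ k)\<^sup>2))"
      by (subst sum.remove[of _ j]) (auto simp: morse_j)
    also have "\<dots> = - (\<Sum>k\<in>UNIV - {j}. (Im (morse z $ k))\<^sup>2) + (\<Sum>k\<in>UNIV - {j}. (Re (morse z $ k))\<^sup>2)"
      by (simp add: Re_power2 sum_subtractf)
    finally show ?thesis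
      using last_pack[of "morse z" "slope (F z)"] 1 2
      by (simp add: torus_chart_milnor_product(1)[OF z] last_def x_def n_def)
  qed
  moreover have "singular_point ?M ?\<Phi> p"
    using singular_point_iff[OF assms(2)] assms(1) p_axis by blast
  moreover have "n - 1 \<le> 2 * CARD('n) - 2" by (simp add: n_def)
  ultimately show ?thesis
    unfolding fold_point_def using local_coords_torus_chart[OF w] by blast
qed

end

theorem proposition4p1:
  fixes c d :: "'n::finite \<Rightarrow> complex"
    and m :: nat
    and f g :: "complex ^ 'n \<Rightarrow> complex"
  assumes "CARD('n) \<ge> 2" and "m \<ge> 2"
    and "\<And>z. f z = (\<Sum>j\<in>UNIV. c j * (z $ j) ^ m)"
    and "\<And>z. g z = (\<Sum>k\<in>UNIV. d k * (z $ k) ^ m)"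
    and "\<And>j. c j \<noteq> 0" and "\<And>k. d k \<noteq> 0"
    and "\<And>j k. j \<noteq> k \<Longrightarrow> c j * d k - c k * d j \<noteq> 0"
  shows "\<exists>\<epsilon>\<^sub>0>0. \<forall>\<epsilon>. 0 < \<epsilon> \<and> \<epsilon> \<le> \<epsilon>\<^sub>0 \<longrightarrow>
    (let M = sphere 0 \<epsilon> - milnor_link f g \<epsilon>; \<Phi> = milnor_product f g in
      (m = 2 \<longrightarrow> fold_map M torus \<Phi>) \<and>
      (m > 2 \<longrightarrow> (\<forall>p. \<not> fold_point M torus \<Phi> p) \<and> (\<exists>p. singular_point M \<Phi> p)))"
proof -
  interpret fp: fermat_pair c d m
    using assms by unfold_locales auto
  have fg: "f = fp.f" "g = fp.g" using assms(3,4) by (auto simp: fp.f_def fp.g_def)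
  have "fold_map (fp.link_complement \<epsilon>) torus (milnor_product f g)" if eps: "\<epsilon> > 0" and m: "m = 2" for \<epsilon>
    unfolding fold_map_def
  proof (intro conjI allI impI)
    show "smooth_map (fp.link_complement \<epsilon>) (milnor_product f g)"
      unfolding fg by (rule smooth_mapI[OF fp.smooth_milnor_product]) (simp add: fp.link_complement_eq)
    show "milnor_product f g ` fp.link_complement \<epsilon> \<subseteq> torus"
      by (auto simp: fg fp.link_complement_eq torus_def milnor_product_def norm_divide)
    fix p assume "singular_point (fp.link_complement \<epsilon>) (milnor_product f g) p"
    then obtain j where j: "norm p = \<epsilon>" "fp.axis_point j p"
      unfolding fg using fp.singular_point_iff[OF eps] by blast
    \<comment> \<open>The Morse chart depends on the axis and on the point, so it is set up anew at
      each singular point.\<close>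
    then interpret quadratic_chart c d m j p
      using m by unfold_locales auto
    show "fold_point (fp.link_complement \<epsilon>) torus (milnor_product f g) p"
      unfolding fg by (rule fold_point_axis[OF j(1) eps assms(1)])
  qed
  moreover have "\<not> fold_point (fp.link_complement \<epsilon>) torus (milnor_product f g) p" if "\<epsilon> > 0" "m > 2" for \<epsilon> p
    unfolding fg by (rule fp.not_fold_point[OF that assms(1)])
  moreover have "\<exists>p. singular_point (fp.link_complement \<epsilon>) (milnor_product f g) p" if "\<epsilon> > 0" for \<epsilon>
    unfolding fg using fp.singular_point_iff[OF that] fp.axis_point_exists[OF that] by blast
  moreover have "fp.link_complement \<epsilon> = sphere 0 \<epsilon> - milnor_link f g \<epsilon>" for \<epsilon>
    by (simp add: fp.link_complement_def fg)
  \<comment> \<open>The assertions hold for every positive \<epsilon>, so the bound may be taken to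
    be 1.\<close>
  ultimately show ?thesis unfolding Let_def by (metis zero_less_one)
qed

end
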